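(* Let $E$ be an arbitrary directed graph and $K$ any field. The ideal $I(P_{ppi})$ of $L_K(E)$ is purely infinite.
   Context: A directed graph $E=(E^0,E^1,s,r)$ consists of arbitrary sets $E^0$ (vertices), $E^1$ (edges) and maps $s,r:E^1\to E^0$ (source, range). A vertex $v$ is a sink if $s^{-1}(v)=\emptyset$, an infinite emitter if $s^{-1}(v)$ is infinite, and regular otherwise. A path is a vertex (length $0$) or a finite sequence of edges $e_1\cdots e_n$ with $r(e_i)=s(e_{i+1})$. Write $u\ge v$ if there is a path from $u$ to $v$, and $T(v)=\{u\in E^0: v\ge u\}$. A set $H\subseteq E^0$ is hereditary if $v\in H$, $v\ge w$ imply $w\in H$; it is saturated if for every regular vertex $v$, $r(s^{-1}(v))\subseteq H$ implies $v\in H$. $\overline{X}$ denotes the smallest hereditary and saturated subset of $E^0$ containing $X$. ${\rm CSP}(w)$ is the set of closed simple paths based at $w$, i.e. paths $e_1\cdots e_n$, $n>0$, with $s(e_1)=r(e_n)=w$ and $s(e_i)\ne w$ for $i\ge2$. A vertex $v$ is properly infinite if there exist vertices $w_1,\dots,w_n\in T(v)$ with $|{\rm CSP}(w_i)|\ge 2$ for all $i$ and $v\in\overline{\{w_1,\dots,w_n\}}$. $P_{pi}$ is the set of properly infinite vertices. For a hereditary saturated $H\subseteq E^0$, $B_H=\{v\in E^0\setminus H: v \text{ is an infinite emitter and } 0<|s^{-1}(v)\cap r^{-1}(E^0\setminus H)|<\infty\}$; a breaking vertex is a vertex lying in $B_H$ for some hereditary saturated $H$. Define $P_{ppi}=\{v\in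 E^0: T(v)\subseteq P_{pi}\text{ and }T(v)\text{ has no breaking vertices}\}$. The Leavitt path algebra $L_K(E)$ is the $K$-algebra generated by $\{v: v\in E^0\}\cup\{e,e^*: e\in E^1\}$ subject to: $vw=\delta_{v,w}v$ for $v,w\in E^0$; $s(e)e=e\,r(e)=e$ and $r(e)e^*=e^*s(e)=e^*$ for $e\in E^1$; $e^*e'=\delta_{e,e'}r(e)$ for $e,e'\in E^1$; $v=\sum_{s(e)=v}ee^*$ for every regular vertex $v$. $I(X)$ is the two-sided ideal generated by $X$. A ring $R$ (not necessarily unital) is purely infinite if (1) no quotient of $R$ is a division ring, and (2) whenever $a\in R$ and $b\in RaR$, there are $x,y\in R$ with $b=xay$. An ideal is purely infinite if it is so as a ring. *)

theory Defs
  imports "HOL-Algebra.QuotRing" "Graph_Theory.Digraph" "Graph_Theory.Arc_Walk"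
begin

section \<open>Rings that need not have a unit\<close>

text \<open>
  The rings are carried by the ring record of HOL-Algebra, but its field \<open>one\<close> is never
  inspected: \<^locale>\<open>ring\<close> and \<^locale>\<open>ideal\<close> presuppose a unit and therefore do not apply.
  An ideal \<open>I\<close> of \<open>R\<close>, regarded as a ring, is \<open>R\<lparr>carrier := I\<rparr>\<close>, and the quotient ring is
  the library's \<open>R Quot I\<close>.
\<close>

locale nonunital_ring = abelian_group R for R (structure) +
  assumes m_closed: "\<lbrakk>x \<in> carrier R; y \<in> carrier R\<rbrakk> \<Longrightarrow> x \<otimes> y \<in> carrier R"
    and m_assoc: "\<lbrakk>x \<in> carrier R; y \<in> carrier R; z \<in> carrier R\<rbrakk>
      \<Longrightarrow> (x \<otimes> y) \<otimes> z = x \<otimes> (y \<otimes> z)"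
    and l_distr: "\<lbrakk>x \<in> carrier R; y \<in> carrier R; z \<in> carrier R\<rbrakk>
      \<Longrightarrow> (x \<oplus> y) \<otimes> z = x \<otimes> z \<oplus> y \<otimes> z"
    and r_distr: "\<lbrakk>x \<in> carrier R; y \<in> carrier R; z \<in> carrier R\<rbrakk>
      \<Longrightarrow> z \<otimes> (x \<oplus> y) = z \<otimes> x \<oplus> z \<otimes> y"

locale two_sided_ideal = additive_subgroup I R + nonunital_ring R for I and R (structure) +
  assumes ideal_l_closed: "\<lbrakk>a \<in> I; x \<in> carrier R\<rbrakk> \<Longrightarrow> x \<otimes> a \<in> I"
    and ideal_r_closed: "\<lbrakk>a \<in> I; x \<in> carrier R\<rbrakk> \<Longrightarrow> a \<otimes> x \<in> I"

definition two_sided_ideal_gen :: "('a, 'm) ring_scheme \<Rightarrow> 'a set \<Rightarrow> 'a set" where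
  "two_sided_ideal_gen R S = \<Inter>{I. two_sided_ideal I R \<and> S \<subseteq> I}"

text \<open>The unit of a division ring is existentially quantified: it is not read off the record.\<close>

definition division_ring :: "'a ring \<Rightarrow> bool" where
  "division_ring R \<longleftrightarrow> (\<exists>u. ring (R\<lparr>one := u\<rparr>) \<and> u \<noteq> \<zero>\<^bsub>R\<^esub> \<and>
     Units (R\<lparr>one := u\<rparr>) = carrier R - {\<zero>\<^bsub>R\<^esub>})"

text \<open>\<open>RaR\<close>: the finite sums of elements \<open>x a y\<close>.\<close>

definition sandwich :: "('a, 'm) ring_scheme \<Rightarrow> 'a \<Rightarrow> 'a set" where
  "sandwich R a =
     {(\<Oplus>\<^bsub>R\<^esub>i\<in>{..<n}. x i \<otimes>\<^bsub>R\<^esub> a \<otimes>\<^bsub>R\<^esub> y i) | (n::nat) x y.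
        x \<in> {..<n} \<rightarrow> carrier R \<and> y \<in> {..<n} \<rightarrow> carrier R}"

definition purely_infinite :: "'a ring \<Rightarrow> bool" where
  "purely_infinite R \<longleftrightarrow>
     nonunital_ring R \<and>
     (\<forall>J. two_sided_ideal J R \<longrightarrow> \<not> division_ring (R Quot J)) \<and>
     (\<forall>a\<in>carrier R. \<forall>b\<in>sandwich R a.
        \<exists>x\<in>carrier R. \<exists>y\<in>carrier R. b = x \<otimes>\<^bsub>R\<^esub> a \<otimes>\<^bsub>R\<^esub> y)"


section \<open>Directed graphs\<close>

text \<open>
  Graphs are those of \<^locale>\<open>wf_digraph\<close>: \<open>tail\<close> is the source map, \<open>head\<close> the range map,
  loops and parallel edges are allowed and there is no bound on cardinalities.
\<close>

definition infinite_emitter :: "('v, 'e) pre_digraph \<Rightarrow> 'v \<Rightarrow> bool" where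
  "infinite_emitter E v \<longleftrightarrow> v \<in> verts E \<and> infinite (out_arcs E v)"

definition regular_vertex :: "('v, 'e) pre_digraph \<Rightarrow> 'v \<Rightarrow> bool" where
  "regular_vertex E v \<longleftrightarrow> v \<in> verts E \<and> out_arcs E v \<noteq> {} \<and> finite (out_arcs E v)"

definition connects :: "('v, 'e) pre_digraph \<Rightarrow> 'v \<Rightarrow> 'v \<Rightarrow> bool" where
  "connects E u v \<longleftrightarrow> (\<exists>p. pre_digraph.awalk E u p v)"

definition tree :: "('v, 'e) pre_digraph \<Rightarrow> 'v \<Rightarrow> 'v set" where
  "tree E v = {u \<in> verts E. connects E v u}"

definition hereditary :: "('v, 'e) pre_digraph \<Rightarrow> 'v set \<Rightarrow> bool" where
  "hereditary E H \<longleftrightarrow> H \<subseteq> verts E \<and> (\<forall>v w. v \<in> H \<and> connects E v w \<longrightarrow> w \<in> H)"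

definition saturated :: "('v, 'e) pre_digraph \<Rightarrow> 'v set \<Rightarrow> bool" where
  "saturated E H \<longleftrightarrow>
     H \<subseteq> verts E \<and> (\<forall>v. regular_vertex E v \<and> head E ` out_arcs E v \<subseteq> H \<longrightarrow> v \<in> H)"

definition hs_closure :: "('v, 'e) pre_digraph \<Rightarrow> 'v set \<Rightarrow> 'v set" where
  "hs_closure E X = \<Inter>{H. hereditary E H \<and> saturated E H \<and> X \<subseteq> H}"

definition CSP :: "('v, 'e) pre_digraph \<Rightarrow> 'v \<Rightarrow> 'e list set" where
  "CSP E w = {p. p \<noteq> [] \<and> pre_digraph.awalk E w p w \<and> (\<forall>e\<in>set (tl p). tail E e \<noteq> w)}"

text \<open>
  \<open>|CSP(w)| \<ge> 2\<close> is spelled out as the existence of two distinct elements, since \<open>card\<close> is \<open>0\<close>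
  on infinite sets.
\<close>

definition properly_infinite :: "('v, 'e) pre_digraph \<Rightarrow> 'v \<Rightarrow> bool" where
  "properly_infinite E v \<longleftrightarrow> v \<in> verts E \<and>
     (\<exists>W. finite W \<and> W \<subseteq> tree E v \<and>
        (\<forall>w\<in>W. \<exists>p\<in>CSP E w. \<exists>q\<in>CSP E w. p \<noteq> q) \<and> v \<in> hs_closure E W)"

definition P_pi :: "('v, 'e) pre_digraph \<Rightarrow> 'v set" where
  "P_pi E = {v \<in> verts E. properly_infinite E v}"

definition B_set :: "('v, 'e) pre_digraph \<Rightarrow> 'v set \<Rightarrow> 'v set" where
  "B_set E H = {v \<in> verts E - H. infinite_emitter E v \<and>
     finite {e \<in> out_arcs E v. head E e \<in> verts E - H} \<and>
     {e \<in> out_arcs E v. head E e \<in> verts E - H} \<noteq> {}}"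

definition breaking_vertex :: "('v, 'e) pre_digraph \<Rightarrow> 'v \<Rightarrow> bool" where
  "breaking_vertex E v \<longleftrightarrow> (\<exists>H. hereditary E H \<and> saturated E H \<and> v \<in> B_set E H)"

definition P_ppi :: "('v, 'e) pre_digraph \<Rightarrow> 'v set" where
  "P_ppi E = {v \<in> verts E. tree E v \<subseteq> P_pi E \<and> (\<forall>w\<in>tree E v. \<not> breaking_vertex E w)}"


section \<open>Leavitt path algebras\<close>

datatype ('v, 'e) lpa_gen = Vtx 'v | Edge 'e | Ghost 'e

text \<open>
  The free non-unital \<open>K\<close>-algebra on the generators of \<open>E\<close>: finitely supported
  \<open>K\<close>-valued functions on the non-empty words in the generators, under convolution.
\<close>

type_synonym ('v, 'e, 'k) free_elt = "('v, 'e) lpa_gen list \<Rightarrow> 'k"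

definition lpa_words :: "('v, 'e) pre_digraph \<Rightarrow> ('v, 'e) lpa_gen list set" where
  "lpa_words E =
     {w. w \<noteq> [] \<and> set w \<subseteq> Vtx ` verts E \<union> Edge ` arcs E \<union> Ghost ` arcs E}"

definition free_algebra ::
  "'k::field itself \<Rightarrow> ('v, 'e) pre_digraph \<Rightarrow> ('v, 'e, 'k) free_elt ring" where
  "free_algebra K E =
     \<lparr>carrier = {f. finite {w. f w \<noteq> 0} \<and> {w. f w \<noteq> 0} \<subseteq> lpa_words E},
      mult = (\<lambda>f g w. \<Sum>i\<le>length w. f (take i w) * g (drop i w)),
      one = undefined,
      zero = (\<lambda>_. 0),
      add = (\<lambda>f g w. f w + g w)\<rparr>"

definition monomial :: "('v, 'e) lpa_gen list \<Rightarrow> ('v, 'e, 'k::field) free_elt" where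
  "monomial w = (\<lambda>u. if u = w then 1 else 0)"

text \<open>Each defining relation \<open>l = r\<close> is represented by the difference \<open>l - r\<close>.\<close>

definition lpa_relators ::
  "'k::field itself \<Rightarrow> ('v, 'e) pre_digraph \<Rightarrow> ('v, 'e, 'k) free_elt set" where
  "lpa_relators K E =
     {monomial [Vtx v, Vtx w] - (if v = w then monomial [Vtx v] else (\<lambda>_. 0)) | v w.
        v \<in> verts E \<and> w \<in> verts E} \<union>
     {monomial [Vtx (tail E e), Edge e] - monomial [Edge e] | e. e \<in> arcs E} \<union>
     {monomial [Edge e, Vtx (head E e)] - monomial [Edge e] | e. e \<in> arcs E} \<union>
     {monomial [Vtx (head E e), Ghost e] - monomial [Ghost e] | e. e \<in> arcs E} \<union>
     {monomial [Ghost e, Vtx (tail E e)] - monomial [Ghost e] | e. e \<in> arcs E} \<union>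
     {monomial [Ghost e, Edge f] - (if e = f then monomial [Vtx (head E e)] else (\<lambda>_. 0)) | e f.
        e \<in> arcs E \<and> f \<in> arcs E} \<union>
     {monomial [Vtx v] - (\<lambda>u. \<Sum>e\<in>out_arcs E v. monomial [Edge e, Ghost e] u) | v.
        regular_vertex E v}"

text \<open>
  The relations are imposed in the category of \<open>K\<close>-algebras, so the ideal must be closed under
  scalars; in a non-unital algebra this is not automatic for a ring ideal.
\<close>

definition lpa_rel_ideal ::
  "'k::field itself \<Rightarrow> ('v, 'e) pre_digraph \<Rightarrow> ('v, 'e, 'k) free_elt set" where
  "lpa_rel_ideal K E =
     \<Inter>{J. two_sided_ideal J (free_algebra K E) \<and>
          (\<forall>c. \<forall>f\<in>J. (\<lambda>w. c * f w) \<in> J) \<and> lpa_relators K E \<subseteq> J}"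

definition leavitt_path_algebra ::
  "'k::field itself \<Rightarrow> ('v, 'e) pre_digraph \<Rightarrow> ('v, 'e, 'k) free_elt set ring" where
  "leavitt_path_algebra K E = free_algebra K E Quot lpa_rel_ideal K E"

definition lpa_vertex ::
  "'k::field itself \<Rightarrow> ('v, 'e) pre_digraph \<Rightarrow> 'v \<Rightarrow> ('v, 'e, 'k) free_elt set" where
  "lpa_vertex K E v = lpa_rel_ideal K E +>\<^bsub>free_algebra K E\<^esub> monomial [Vtx v]"

definition lpa_ideal ::
  "'k::field itself \<Rightarrow> ('v, 'e) pre_digraph \<Rightarrow> 'v set \<Rightarrow> ('v, 'e, 'k) free_elt set set" where
  "lpa_ideal K E X = two_sided_ideal_gen (leavitt_path_algebra K E) (lpa_vertex K E ` X)"

end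

theory Submission
  imports Defs "HOL-Library.Sublist"
begin

text \<open>
  Let \<open>a\<close> be an element of \<open>I(P\<^sub>p\<^sub>p\<^sub>i)\<close>, and call a vertex \<open>w\<close> of \<open>P\<^sub>p\<^sub>p\<^sub>i\<close> with at least two closed simple
  paths exposed if \<open>w = x a y\<close> for some \<open>x\<close>, \<open>y\<close>. Then \<open>a\<close> lies in the ideal generated by the exposed
  vertices: otherwise, multiplying by suitable edges turns \<open>a\<close> into a nonzero combination of real paths
  that end outside the hereditary saturated set \<open>Y\<close> of vertices of this ideal (at an infinite emitter
  this uses that there are no breaking vertices), and such a combination is compressed to a vertex with
  two closed simple paths \<open>p \<noteq> q\<close> outside \<open>Y\<close> by means of the paths \<open>p\<^sup>n q\<close>.

  Every finite family of exposed vertices can be split off from \<open>a\<close> simultaneously. For vertices that do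
  not reach each other the cross terms are annihilated by high powers of a closed path, because they lie in
  the ideal of a hereditary set that avoids the base of that path. Repetitions, and vertices that are
  reached from a common one, are separated by the mutually orthogonal paths \<open>p\<^sup>i q\<close>. Hence every sum
  of elements \<open>x a y\<close> is a single such element. No quotient is a division ring because the ghost
  of \<open>p\<close> times \<open>q\<close> is zero.
\<close>

section \<open>Walks\<close>

text \<open>All computations take place in an arbitrary family satisfying the Leavitt relations, and
  nonvanishing enters only relative to an ideal \<open>S\<close>: the alternative to membership in
  \<open>S\<close> is a vertex outside \<open>S\<close>. The induction is on the length of the ghost
  parts in an expression for \<open>a\<close>. Multiplying \<open>path u p * ghost u' q\<close> on
  the right by an edge shortens a nonempty \<open>q\<close> or kills the term, while for empty
  \<open>q\<close> the real path grows instead. The obstacle is a nonregular vertex at which pure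
  paths occur: there is no Cuntz-Krieger relation to recover the element from its products with
  edges. But infinitely many edges lead from this vertex to vertices outside \<open>S\<close>, so
  one of them avoids the finitely many first edges of ghost parts and leaves only pure paths. A
  second constraint is that the factors \<open>x\<close> and \<open>y\<close> have to be found in
  the ideal itself, which may lack a unit. Idempotents \<open>V w\<close> with \<open>w\<close> in
  \<open>P_ppi\<close> are inserted for this purpose.\<close>

lemma concat_replicate_add:
  "concat (replicate (m + n) p) = concat (replicate m p) @ concat (replicate n p)"
  by (simp add: replicate_add)

lemma length_concat_replicate: "length (concat (replicate n p)) = n * length p"
  by (induction n) auto

context wf_digraph
begin

lemma awalk_append_right_iff:
  assumes "awalk u p v"
  shows "awalk u (p @ q) w \<longleftrightarrow> awalk v q w"
  using assms by (auto simp del: awalkE awalkE')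

lemma awalk_append_trans:
  assumes "awalk u p v" "awalk v q w"
  shows "awalk u (p @ q) w"
  using assms awalk_append_right_iff by blast

lemma connects_refl: "v \<in> verts G \<Longrightarrow> connects G v v"
  unfolding connects_def using awalk_Nil_iff by blast

lemma connects_trans: "connects G u v \<Longrightarrow> connects G v w \<Longrightarrow> connects G u w"
  unfolding connects_def using awalk_append_trans by blast

lemma connects_verts:
  assumes "connects G u v"
  shows "u \<in> verts G" "v \<in> verts G"
  using assms unfolding connects_def by (auto intro: awalk_hd_in_verts awalk_last_in_verts)

lemma connects_awalk: "awalk u p v \<Longrightarrow> connects G u v"
  unfolding connects_def by blast

lemma tree_iff: "w \<in> tree G v \<longleftrightarrow> connects G v w"
  unfolding tree_def using connects_verts by blast

lemma hereditary_tree: "hereditary G (tree G v)"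
  unfolding hereditary_def using tree_iff connects_trans connects_verts by blast

lemma hereditaryD: "hereditary G H \<Longrightarrow> v \<in> H \<Longrightarrow> connects G v w \<Longrightarrow> w \<in> H"
  unfolding hereditary_def by blast

lemma hereditary_subset: "hereditary G H \<Longrightarrow> H \<subseteq> verts G"
  unfolding hereditary_def by blast

lemma hereditary_verts: "hereditary G (verts G)"
  unfolding hereditary_def using connects_verts by blast

lemma awalk_concat_replicate:
  assumes "awalk w p w"
  shows "awalk w (concat (replicate n p)) w"
proof (induction n)
  case 0
  show ?case using assms awalk_hd_in_verts by (simp add: awalk_Nil_iff)
next
  case (Suc n)
  then show ?case using assms awalk_append_trans by simp
qed

subsection \<open>Closed simple paths\<close>

lemma CSP_awalk: "p \<in> CSP G w \<Longrightarrow> awalk w p w"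
  and CSP_nonempty: "p \<in> CSP G w \<Longrightarrow> p \<noteq> []"
  unfolding CSP_def by auto

text \<open>The edge of \<open>p\<close> that follows a proper prefix \<open>d\<close> would start
  at \<open>w\<close>, which only the first edge of a closed simple path does.\<close>

lemma CSP_prefix_eq:
  assumes p: "p \<in> CSP G w" and d: "awalk w d w" "d \<noteq> []" and pre: "prefix d p"
  shows "d = p"
proof (rule ccontr)
  assume "d \<noteq> p"
  obtain r where r: "p = d @ r" using pre by (auto simp: prefix_def)
  with \<open>d \<noteq> p\<close> obtain e r' where e: "r = e # r'" by (cases r) auto
  have "awalk w r w" using CSP_awalk[OF p] d(1) r awalk_append_right_iff by blast
  then have "tail G e = w" using e by (simp add: awalk_Cons_iff)
  moreover have "e \<in> set (tl p)" using r e d(2) by (cases d) auto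
  ultimately show False using p unfolding CSP_def by auto
qed

text \<open>Closed simple paths at \<open>w\<close> form a prefix code. This is the source of all
  orthogonality relations between closed paths below.\<close>

lemma CSP_parallel:
  assumes "p \<in> CSP G w" "q \<in> CSP G w" "p \<noteq> q"
  shows "p \<parallel> q"
  using assms CSP_prefix_eq CSP_awalk CSP_nonempty by (metis parallelI)

text \<open>Copies of \<open>p\<close> are peeled off: a nonempty \<open>d\<close> cannot be a
  proper prefix of \<open>p\<close>, so it begins with \<open>p\<close>. Since \<open>p\<close> is
  nonempty, \<open>length d \<le> n\<close> makes \<open>d\<close> run out within the
  \<open>n\<close> copies, whatever the tail \<open>r\<close> is.\<close>

lemma closed_walk_prefix_CSP_power:
  assumes p: "p \<in> CSP G w" and d: "awalk w d w" and pre: "prefix d (concat (replicate n p) @ r)"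
    and len: "length d \<le> n"
  shows "\<exists>j\<le>n. d = concat (replicate j p)"
  using d pre len
proof (induction n arbitrary: d)
  case 0
  then show ?case by auto
next
  case (Suc n)
  show ?case
  proof (cases "d = []")
    case True
    then show ?thesis by (intro exI[of _ 0]) auto
  next
    case False
    have pp: "prefix p (concat (replicate (Suc n) p) @ r)" by simp
    have "prefix p d"
      using prefix_same_cases[OF pp Suc.prems(2)] CSP_prefix_eq[OF p Suc.prems(1) False] by auto
    then obtain d' where d': "d = p @ d'" by (auto simp: prefix_def)
    have "awalk w d' w" using Suc.prems(1) CSP_awalk[OF p] awalk_append_right_iff d' by blast
    moreover have "prefix d' (concat (replicate n p) @ r)" using Suc.prems(2) d' by simp
    moreover have "length d' \<le> n" using Suc.prems(3) d' CSP_nonempty[OF p] by (cases p) auto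
    ultimately obtain j where "j \<le> n" "d' = concat (replicate j p)" using Suc.IH by blast
    then show ?thesis using d' by (intro exI[of _ "Suc j"]) auto
  qed
qed

text \<open>
  If \<open>p\<^sup>n q\<close> were a prefix of \<open>d p\<^sup>n q\<close>, then \<open>d\<close> would be a power of \<open>p\<close>; the final \<open>q\<close>
  breaks this periodicity.
\<close>

lemma CSP_power_shift_parallel:
  assumes p: "p \<in> CSP G w" and q: "q \<in> CSP G w" and "p \<noteq> q"
    and d: "awalk w d w" "d \<noteq> []" and len: "length d \<le> n"
  shows "concat (replicate n p) @ q \<parallel> d @ concat (replicate n p) @ q"
proof (rule parallelI)
  let ?c = "concat (replicate n p) @ q"
  show "\<not> prefix ?c (d @ ?c)"
  proof
    assume pre: "prefix ?c (d @ ?c)"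
    have "length d \<le> length ?c"
      using len CSP_nonempty[OF p] by (cases p) (auto simp: length_concat_replicate)
    moreover have "prefix d (d @ ?c)" by simp
    ultimately have "prefix d ?c" using pre prefix_length_prefix by blast
    then obtain j where j: "j \<le> n" "d = concat (replicate j p)"
      using closed_walk_prefix_CSP_power[OF p d(1) _ len] by blast
    have "j \<noteq> 0" using j d by auto
    then obtain i where i: "j = Suc i" by (cases j) auto
    \<comment> \<open>Powers of \<open>p\<close> commute, so the \<open>n\<close> copies cancel and
      \<open>q\<close> would be comparable with \<open>d @ q\<close>, which begins with
      \<open>p\<close>.\<close>
    have "d @ ?c = concat (replicate n p) @ d @ q"
      using j by (metis add.commute append.assoc concat_replicate_add)
    then have "prefix q (d @ q)" using pre by (metis same_prefix_prefix)
    moreover have "prefix p (d @ q)" using j i by simp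
    ultimately show False
      using prefix_same_cases CSP_parallel[OF p q \<open>p \<noteq> q\<close>] by blast
  qed
  show "\<not> prefix (d @ ?c) ?c"
    using d(2) by (auto dest: prefix_length_le)
qed

text \<open>After the common power of \<open>p\<close> is cancelled, one path continues with
  \<open>q\<close> and the other with \<open>p\<close>.\<close>

lemma CSP_power_parallel:
  assumes p: "p \<in> CSP G w" and q: "q \<in> CSP G w" and "p \<noteq> q" and "i \<noteq> (j::nat)"
  shows "concat (replicate i p) @ q \<parallel> concat (replicate j p) @ q"
proof -
  have *: "concat (replicate i p) @ q \<parallel> concat (replicate j p) @ q" if "i < j" for i j :: nat
  proof -
    obtain k where k: "j = i + Suc k" using \<open>i < j\<close> less_iff_Suc_add by auto
    have "q \<parallel> p" using CSP_parallel assms by (metis)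
    then have "q @ [] \<parallel> p @ concat (replicate k p) @ q" using parallel_append by blast
    moreover have "concat (replicate j p) @ q
        = concat (replicate i p) @ p @ concat (replicate k p) @ q"
      unfolding k concat_replicate_add by simp
    ultimately show ?thesis by (simp add: parallel_def del: replicate_Suc)
  qed
  show ?thesis
  proof (cases "i < j")
    case False
    then have "j < i" using \<open>i \<noteq> j\<close> by simp
    from *[OF this] show ?thesis using parallel_commute by blast
  qed (rule *)
qed

end

section \<open>Vertices of \<open>P\<^sub>p\<^sub>i\<close> and \<open>P\<^sub>p\<^sub>p\<^sub>i\<close>\<close>

definition branching :: "('v, 'e) pre_digraph \<Rightarrow> 'v \<Rightarrow> bool" where
  "branching E w \<longleftrightarrow> (\<exists>p\<in>CSP E w. \<exists>q\<in>CSP E w. p \<noteq> q)"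

context wf_digraph
begin

lemma branching_verts: "branching G w \<Longrightarrow> w \<in> verts G"
  unfolding branching_def using CSP_awalk awalk_hd_in_verts by blast

lemma hereditary_P_ppi: "hereditary G (P_ppi G)"
  unfolding hereditary_def
proof (intro conjI allI impI)
  show "P_ppi G \<subseteq> verts G" unfolding P_ppi_def by auto
  fix v w assume vw: "v \<in> P_ppi G \<and> connects G v w"
  then have "tree G w \<subseteq> tree G v" using tree_iff connects_trans by blast
  then show "w \<in> P_ppi G" using vw connects_verts unfolding P_ppi_def by blast
qed

lemma P_ppi_subset: "P_ppi G \<subseteq> P_pi G"
  unfolding P_ppi_def using tree_iff connects_refl by blast

lemma P_ppi_not_breaking: "v \<in> P_ppi G \<Longrightarrow> \<not> breaking_vertex G v"
  unfolding P_ppi_def using tree_iff connects_refl by blast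

text \<open>If all witnesses of proper infiniteness were in \<open>Y\<close>, then so would be their
  hereditary saturated closure, which contains \<open>v\<close>.\<close>

lemma P_pi_reaches_branching:
  assumes v: "v \<in> P_pi G" and Y: "hereditary G Y" "saturated G Y" and "v \<notin> Y"
  obtains w where "connects G v w" "w \<notin> Y" "branching G w"
proof -
  obtain W where W: "W \<subseteq> tree G v" "\<forall>w\<in>W. \<exists>p\<in>CSP G w. \<exists>q\<in>CSP G w. p \<noteq> q"
    "v \<in> hs_closure G W"
    using v unfolding P_pi_def properly_infinite_def by blast
  have "\<not> W \<subseteq> Y" using W(3) Y \<open>v \<notin> Y\<close> unfolding hs_closure_def by blast
  then show thesis using that W tree_iff unfolding branching_def by blast
qed

text \<open>A nonregular vertex cannot enter a closure through saturation, so \<open>v\<close> is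
  reached from one of its witnesses. As \<open>v\<close> also reaches that witness, it lies on a
  closed walk; the first edge of this walk leads back to \<open>v\<close>, so its range is outside
  \<open>Y\<close>.\<close>

lemma P_pi_nonregular_emits_outside:
  assumes v: "v \<in> P_pi G" and nonreg: "\<not> regular_vertex G v"
    and Y: "hereditary G Y" "v \<notin> Y"
  obtains e where "e \<in> out_arcs G v" "head G e \<in> verts G - Y"
proof -
  have vv: "v \<in> verts G" using v unfolding P_pi_def by simp
  obtain W where W: "W \<subseteq> tree G v" "\<forall>w\<in>W. \<exists>p\<in>CSP G w. \<exists>q\<in>CSP G w. p \<noteq> q"
    "v \<in> hs_closure G W"
    using v unfolding P_pi_def properly_infinite_def by blast
  have "\<exists>w\<in>W. connects G w v"
  proof (rule ccontr)
    assume no: "\<not> (\<exists>w\<in>W. connects G w v)"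
    \<comment> \<open>If no witness reaches \<open>v\<close>, deleting from the closure everything
      that leads to \<open>v\<close> keeps it hereditary, saturated and containing \<open>W\<close>.
      Saturation survives because \<open>v\<close> is not regular.\<close>
    define C where "C = hs_closure G W \<inter> {u \<in> verts G. \<not> connects G u v}"
    have herC: "x \<in> hs_closure G W" if "u \<in> hs_closure G W" "connects G u x" for u x
      using that unfolding hs_closure_def hereditary_def by blast
    have satC: "u \<in> hs_closure G W" if "regular_vertex G u"
      "head G ` out_arcs G u \<subseteq> hs_closure G W" for u
      using that unfolding hs_closure_def saturated_def by blast
    have "hereditary G C"
      unfolding hereditary_def C_def using herC connects_trans connects_verts by blast
    moreover have "saturated G C"
      unfolding saturated_def
    proof (intro conjI allI impI)
      show "C \<subseteq> verts G" unfolding C_def by blast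
      fix u assume u: "regular_vertex G u \<and> head G ` out_arcs G u \<subseteq> C"
      have uv: "u \<in> verts G" using u unfolding regular_vertex_def by blast
      have "\<not> connects G u v"
      proof
        assume "connects G u v"
        then obtain p where p: "awalk u p v" unfolding connects_def by blast
        show False
        proof (cases p)
          case Nil
          then show False using p u nonreg by (simp add: awalk_Nil_iff)
        next
          case (Cons e r)
          then have "e \<in> out_arcs G u" "awalk (head G e) r v"
            using p by (auto simp: awalk_Cons_iff)
          then show False using u connects_awalk unfolding C_def by blast
        qed
      qed
      moreover have "u \<in> hs_closure G W" using u satC unfolding C_def by blast
      ultimately show "u \<in> C" using uv unfolding C_def by blast
    qed
    moreover have "W \<subseteq> C"
      using no W(1) unfolding C_def hs_closure_def tree_def by blast
    ultimately have "v \<in> C" using W(3) unfolding hs_closure_def by blast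
    then show False using connects_refl[OF vv] unfolding C_def by blast
  qed
  then obtain w where w: "w \<in> W" "connects G w v" by blast
  obtain p where p: "p \<in> CSP G w" using W(2) w by blast
  obtain r where r: "awalk v r w" using W(1) w tree_iff unfolding connects_def by blast
  obtain s where s: "awalk w s v" using w unfolding connects_def by blast
  \<comment> \<open>Both \<open>r\<close> and \<open>s\<close> are empty if \<open>v\<close> is
    itself the witness; inserting \<open>p\<close> guarantees a first edge.\<close>
  have "awalk v (r @ p @ s) v"
    using r s CSP_awalk[OF p] awalk_append_trans by blast
  moreover have "r @ p @ s \<noteq> []" using CSP_nonempty[OF p] by simp
  ultimately obtain e t where e: "e \<in> arcs G" "tail G e = v" "awalk (head G e) t v"
    by (metis awalk_Cons_iff neq_Nil_conv)
  have "head G e \<notin> Y" using hereditaryD[OF Y(1)] Y(2) connects_awalk[OF e(3)] by blast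
  then show thesis using that[of e] e(1,2) by simp
qed

text \<open>At least one edge of \<open>v\<close> ends outside \<open>Y\<close>; if there were only
  finitely many, \<open>v\<close> would be a breaking vertex for \<open>Y\<close>.\<close>

lemma P_ppi_nonregular_emits_infinitely:
  assumes v: "v \<in> P_ppi G" and nonreg: "\<not> regular_vertex G v"
    and Y: "hereditary G Y" "saturated G Y" "v \<notin> Y"
  shows "infinite {e \<in> out_arcs G v. head G e \<in> verts G - Y}"
proof -
  have vpi: "v \<in> P_pi G" using v P_ppi_subset by blast
  then have vv: "v \<in> verts G" unfolding P_pi_def by simp
  obtain e where e: "e \<in> out_arcs G v" "head G e \<in> verts G - Y"
    using P_pi_nonregular_emits_outside[OF vpi nonreg Y(1,3)] by blast
  have "infinite_emitter G v"
    using nonreg vv e unfolding regular_vertex_def infinite_emitter_def by blast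
  then show ?thesis
    using P_ppi_not_breaking[OF v] Y e vv unfolding breaking_vertex_def B_set_def by blast
qed

end

section \<open>Leavitt families in algebras\<close>

text \<open>The family sits in an ambient type class ring that may be much larger than the algebra
  it generates. That algebra is recovered below as \<open>L\<close>.\<close>

locale leavitt_family = wf_digraph E + vector_space scale
  for E :: "('v, 'e) pre_digraph"
    and scale :: "'k::field \<Rightarrow> 'a::ring \<Rightarrow> 'a" (infixr \<open>*s\<close> 75) +
  fixes V :: "'v \<Rightarrow> 'a" and X :: "'e \<Rightarrow> 'a" and X' :: "'e \<Rightarrow> 'a"
  assumes scale_mult_left: "(c *s a) * b = c *s (a * b)"
    and scale_mult_right: "a * (c *s b) = c *s (a * b)"
    and V_V: "v \<in> verts E \<Longrightarrow> w \<in> verts E \<Longrightarrow> V v * V w = (if v = w then V v else 0)"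
    and tail_X: "e \<in> arcs E \<Longrightarrow> V (tail E e) * X e = X e"
    and X_head: "e \<in> arcs E \<Longrightarrow> X e * V (head E e) = X e"
    and head_X': "e \<in> arcs E \<Longrightarrow> V (head E e) * X' e = X' e"
    and X'_tail: "e \<in> arcs E \<Longrightarrow> X' e * V (tail E e) = X' e"
    and X'_X: "e \<in> arcs E \<Longrightarrow> f \<in> arcs E \<Longrightarrow> X' e * X f = (if e = f then V (head E e) else 0)"
    and Cuntz_Krieger: "regular_vertex E v \<Longrightarrow> V v = (\<Sum>e\<in>out_arcs E v. X e * X' e)"
begin

text \<open>The start vertex is an argument because an empty edge list does not determine the vertex
  it stands for.\<close>

primrec path :: "'v \<Rightarrow> 'e list \<Rightarrow> 'a" where
  "path u [] = V u"
| "path u (e # p) = X e * path (head E e) p"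

primrec ghost :: "'v \<Rightarrow> 'e list \<Rightarrow> 'a" where
  "ghost u [] = V u"
| "ghost u (e # p) = ghost (head E e) p * X' e"

lemma V_path: "awalk u p v \<Longrightarrow> V u * path u p = path u p"
  by (cases p) (auto simp: awalk_simps V_V tail_X mult.assoc[symmetric])

lemma ghost_V: "awalk u p v \<Longrightarrow> ghost u p * V u = ghost u p"
  by (cases p) (auto simp: awalk_simps V_V X'_tail mult.assoc)

lemma path_V: "awalk u p v \<Longrightarrow> path u p * V v = path u p"
  by (induction p arbitrary: u) (auto simp: awalk_simps V_V mult.assoc)

lemma V_ghost: "awalk u p v \<Longrightarrow> V v * ghost u p = ghost u p"
  by (induction p arbitrary: u) (auto simp: awalk_simps V_V mult.assoc[symmetric])

lemma path_append: "awalk u p v \<Longrightarrow> awalk v q w \<Longrightarrow> path u (p @ q) = path u p * path v q"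
  by (induction p arbitrary: u) (auto simp: awalk_simps V_path mult.assoc)

lemma ghost_append: "awalk u p v \<Longrightarrow> awalk v q w \<Longrightarrow> ghost u (p @ q) = ghost v q * ghost u p"
  by (induction p arbitrary: u) (auto simp: awalk_simps ghost_V mult.assoc)

lemma ghost_path: "awalk u p v \<Longrightarrow> ghost u p * path u p = V v"
proof (induction p arbitrary: u)
  case Nil
  then show ?case by (auto simp: awalk_simps V_V)
next
  case (Cons e p)
  then have e: "e \<in> arcs E" "awalk (head E e) p v" by (auto simp: awalk_simps)
  have "ghost u (e # p) * path u (e # p)
      = ghost (head E e) p * (X' e * X e) * path (head E e) p"
    by (simp add: mult.assoc)
  also have "\<dots> = ghost (head E e) p * path (head E e) p"
    using e by (simp add: X'_X ghost_V)
  finally show ?case using Cons.IH e by simp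
qed

text \<open>At the first position where the two edge lists differ, \<open>X' e * X f\<close>
  vanishes.\<close>

lemma ghost_path_parallel:
  assumes "awalk u p v" "awalk u q w" "p \<parallel> q"
  shows "ghost u p * path u q = 0"
  using assms
proof (induction p arbitrary: u q)
  case Nil
  then show ?case by simp
next
  case (Cons e p)
  from Cons.prems(3) obtain f r where q: "q = f # r" by (cases q) auto
  have e: "e \<in> arcs E" "awalk (head E e) p v" using Cons.prems by (auto simp: awalk_simps)
  have f: "f \<in> arcs E" "awalk (head E f) r w" using Cons.prems q by (auto simp: awalk_simps)
  have *: "ghost u (e # p) * path u q = ghost (head E e) p * (X' e * X f) * path (head E f) r"
    by (simp add: mult.assoc q)
  show ?case
  proof (cases "e = f")
    case True
    then have "p \<parallel> r" using Cons.prems(3) q by (auto simp: parallel_def)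
    then show ?thesis using * Cons.IH[of "head E e" r] e f True by (simp add: X'_X ghost_V)
  qed (use * e f in \<open>simp add: X'_X\<close>)
qed

lemma ghost_path_distinct_start:
  assumes "awalk u p v" "awalk u' q w" "u \<noteq> u'"
  shows "ghost u p * path u' q = 0"
proof -
  have "ghost u p * path u' q = ghost u p * (V u * V u') * path u' q"
    using assms by (metis V_path ghost_V mult.assoc)
  also have "\<dots> = 0" using assms by (simp add: V_V awalk_hd_in_verts)
  finally show ?thesis .
qed

lemma ghost_path_prefix:
  assumes "awalk u p v" "awalk v r w"
  shows "ghost u p * path u (p @ r) = path v r" "ghost u (p @ r) * path u p = ghost v r"
proof -
  show "ghost u p * path u (p @ r) = path v r"
    by (simp add: path_append[OF assms] mult.assoc[symmetric] ghost_path[OF assms(1)]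
        V_path[OF assms(2)])
  show "ghost u (p @ r) * path u p = ghost v r"
    by (simp add: ghost_append[OF assms] mult.assoc ghost_path[OF assms(1)]
        ghost_V[OF assms(2)])
qed

subsection \<open>Spans of monomials\<close>

text \<open>Only the ghost part is bounded: it is the measure of the induction in
  \<open>mem_or_exposes\<close>, during which real parts may grow.\<close>

definition monomials :: "'v set \<Rightarrow> nat \<Rightarrow> 'a set" where
  "monomials H n = {path u p * ghost u' q | u p u' q v.
     v \<in> H \<and> awalk u p v \<and> awalk u' q v \<and> length q \<le> n}"

text \<open>For hereditary \<open>H\<close> this is the ideal of \<open>L\<close> generated by the
  vertices in \<open>H\<close>.\<close>

definition lspan :: "'v set \<Rightarrow> 'a set" where
  "lspan H = span (\<Union>n. monomials H n)"

lemma monomialsI: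
  "v \<in> H \<Longrightarrow> awalk u p v \<Longrightarrow> awalk u' q v \<Longrightarrow> length q \<le> n
    \<Longrightarrow> path u p * ghost u' q \<in> monomials H n"
  unfolding monomials_def by blast

lemma lspan_monomial:
  "v \<in> H \<Longrightarrow> awalk u p v \<Longrightarrow> awalk u' q v \<Longrightarrow> path u p * ghost u' q \<in> lspan H"
  unfolding lspan_def by (rule span_base) (blast intro: monomialsI)

lemma lspan_path: "v \<in> H \<Longrightarrow> awalk u p v \<Longrightarrow> path u p \<in> lspan H"
  using lspan_monomial[of v H u p v "[]"] awalk_last_in_verts
  by (auto simp: awalk_Nil_iff path_V)

lemma lspan_ghost: "v \<in> H \<Longrightarrow> awalk u p v \<Longrightarrow> ghost u p \<in> lspan H"
  using lspan_monomial[of v H v "[]" u p] awalk_last_in_verts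
  by (auto simp: awalk_Nil_iff V_ghost)

lemma lspan_V: "v \<in> H \<Longrightarrow> v \<in> verts E \<Longrightarrow> V v \<in> lspan H"
  using lspan_path[of v H v "[]"] by (simp add: awalk_Nil_iff)

lemma lspan_mono: "A \<subseteq> B \<Longrightarrow> lspan A \<subseteq> lspan B"
  unfolding lspan_def monomials_def by (intro span_mono) blast

lemma lspan_add: "a \<in> lspan H \<Longrightarrow> b \<in> lspan H \<Longrightarrow> a + b \<in> lspan H"
  and lspan_0: "0 \<in> lspan H"
  and lspan_scale: "a \<in> lspan H \<Longrightarrow> c *s a \<in> lspan H"
  and lspan_minus: "a \<in> lspan H \<Longrightarrow> - a \<in> lspan H"
  unfolding lspan_def by (auto intro: span_add span_zero span_scale span_neg)

lemma lspan_sum: "(\<And>i. i \<in> I \<Longrightarrow> f i \<in> lspan H) \<Longrightarrow> sum f I \<in> lspan H"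
  unfolding lspan_def by (rule span_sum)

lemma lspan_induct [consumes 1, case_names zero step]:
  assumes "a \<in> lspan H" "P 0"
    and "\<And>c u p u' q v a. v \<in> H \<Longrightarrow> awalk u p v \<Longrightarrow> awalk u' q v \<Longrightarrow> a \<in> lspan H \<Longrightarrow> P a
      \<Longrightarrow> P (c *s (path u p * ghost u' q) + a)"
  shows "P a"
proof -
  have "a \<in> lspan H \<and> P a"
    using assms(1) unfolding lspan_def
  proof (induction rule: span_induct_alt)
    case base
    show ?case using assms(2) span_zero by simp
  next
    case (step c x y)
    then obtain u p u' q v where "x = path u p * ghost u' q" "v \<in> H" "awalk u p v" "awalk u' q v"
      unfolding monomials_def by blast
    moreover have "c *s x + y \<in> span (\<Union>n. monomials H n)"
      using step by (blast intro: span_add span_scale span_base)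
    ultimately show ?case using step assms(3) unfolding lspan_def by blast
  qed
  then show ?thesis ..
qed

text \<open>Unless the inner factors annihilate each other, one of \<open>q\<close> and
  \<open>r\<close> extends the other. The new middle vertex is then the middle vertex of one factor
  and reachable from that of the other, so it lies in both hereditary sets.\<close>

lemma monomial_mult:
  assumes H: "hereditary E A" "hereditary E B"
    and 1: "v \<in> A" "awalk u p v" "awalk u' q v"
    and 2: "w \<in> B" "awalk x r w" "awalk x' s w"
  shows "(path u p * ghost u' q) * (path x r * ghost x' s) \<in> lspan (A \<inter> B)"
proof -
  have eq: "(path u p * ghost u' q) * (path x r * ghost x' s)
      = path u p * (ghost u' q * path x r) * ghost x' s" by (simp add: mult.assoc)
  consider "u' \<noteq> x" | "u' = x" "q \<parallel> r" | t where "u' = x" "r = q @ t" | t where "u' = x" "q = r @ t"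
    by (auto simp: parallel_def prefix_def)
  then show ?thesis
  proof cases
    case 1
    then show ?thesis using eq ghost_path_distinct_start assms by (simp add: lspan_0)
  next
    case 2
    then show ?thesis using eq ghost_path_parallel assms by (simp add: lspan_0)
  next
    case 3
    then have t: "awalk v t w" using assms awalk_append_right_iff by blast
    then have "(path u p * ghost u' q) * (path x r * ghost x' s) = path u (p @ t) * ghost x' s"
      using eq 3 assms ghost_path_prefix(1)[OF 1(3) t] path_append[OF 1(2) t] by simp
    moreover have "w \<in> A \<inter> B" using t assms hereditaryD connects_awalk by blast
    ultimately show ?thesis using lspan_monomial awalk_append_trans[OF 1(2) t] assms by simp
  next
    case 4
    then have t: "awalk w t v" using assms awalk_append_right_iff by blast
    then have "(path u p * ghost u' q) * (path x r * ghost x' s) = path u p * ghost x' (s @ t)"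
      using eq 4 assms ghost_path_prefix(2)[OF 2(2) t] ghost_append[OF 2(3) t]
      by (simp add: mult.assoc)
    moreover have "v \<in> A \<inter> B" using t assms hereditaryD connects_awalk by blast
    ultimately show ?thesis using lspan_monomial awalk_append_trans[OF 2(3) t] assms by simp
  qed
qed

lemma lspan_mult:
  assumes H: "hereditary E A" "hereditary E B" and a: "a \<in> lspan A" and b: "b \<in> lspan B"
  shows "a * b \<in> lspan (A \<inter> B)"
  using a
proof (induction rule: lspan_induct)
  case zero
  show ?case by (simp add: lspan_0)
next
  case (step c u p u' q v a)
  have "(path u p * ghost u' q) * b \<in> lspan (A \<inter> B)"
    using b
  proof (induction rule: lspan_induct)
    case zero
    show ?case by (simp add: lspan_0)
  next
    case (step d x r x' s w b)
    then show ?case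
      using monomial_mult[OF H \<open>v \<in> A\<close> \<open>awalk u p v\<close> \<open>awalk u' q v\<close>]
      by (simp add: distrib_left scale_mult_right lspan_add lspan_scale)
  qed
  then show ?case
    using step by (simp add: distrib_right scale_mult_left lspan_add lspan_scale)
qed

abbreviation L :: "'a set" where
  "L \<equiv> lspan (verts E)"

lemma lspan_subset_L: "hereditary E H \<Longrightarrow> lspan H \<subseteq> L"
  by (intro lspan_mono hereditary_subset)

lemma lspan_mult_left:
  assumes H: "hereditary E H" and "a \<in> L" "b \<in> lspan H"
  shows "a * b \<in> lspan H"
  using lspan_mult[OF hereditary_verts H assms(2,3)] hereditary_subset[OF H]
  by (simp add: Int_absorb1)

lemma lspan_mult_right:
  assumes H: "hereditary E H" and "a \<in> lspan H" "b \<in> L"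
  shows "a * b \<in> lspan H"
  using lspan_mult[OF H hereditary_verts assms(2,3)] hereditary_subset[OF H]
  by (simp add: Int_absorb2)

lemma L_mult: "a \<in> L \<Longrightarrow> b \<in> L \<Longrightarrow> a * b \<in> L"
  using lspan_mult_left hereditary_verts by blast

lemma L_path: "awalk u p v \<Longrightarrow> path u p \<in> L"
  and L_ghost: "awalk u p v \<Longrightarrow> ghost u p \<in> L"
  and L_V: "v \<in> verts E \<Longrightarrow> V v \<in> L"
  by (simp_all add: lspan_path[OF awalk_last_in_verts] lspan_ghost[OF awalk_last_in_verts] lspan_V)

lemma L_X: "e \<in> arcs E \<Longrightarrow> X e \<in> L"
  using L_path[of "tail E e" "[e]" "head E e"] by (simp add: awalk_simps X_head)

lemma L_X': "e \<in> arcs E \<Longrightarrow> X' e \<in> L"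
  using L_ghost[of "tail E e" "[e]" "head E e"] by (simp add: awalk_simps head_X')

subsection \<open>High powers of a closed path annihilate smaller ideals\<close>

text \<open>A path \<open>r\<close> that ends in \<open>Y\<close> is no prefix of a power of
  \<open>p\<close>, since the remainder would lead from \<open>Y\<close> back to \<open>w\<close>.
  Conversely, a power with more than \<open>length r\<close> factors is too long to be a prefix of
  \<open>r\<close>. Hence each monomial of \<open>z\<close> is killed by all large powers.\<close>

lemma ghost_power_annihilates:
  assumes Y: "hereditary E Y" and w: "w \<notin> Y" and p: "awalk w p w" "p \<noteq> []" and z: "z \<in> lspan Y"
  shows "\<forall>\<^sub>F n in sequentially. ghost w (concat (replicate n p)) * z = 0"
  using z
proof (induction rule: lspan_induct)
  case zero
  show ?case by simp
next
  case (step c u r u' q v a)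
  have "\<forall>\<^sub>F n in sequentially. ghost w (concat (replicate n p)) * path u r = 0"
    unfolding eventually_sequentially
  proof (intro exI[of _ "Suc (length r)"] allI impI)
    fix n assume n: "Suc (length r) \<le> n"
    let ?c = "concat (replicate n p)"
    have c: "awalk w ?c w" using p awalk_concat_replicate by blast
    show "ghost w ?c * path u r = 0"
    proof (cases "u = w")
      case True
      have "length r < length ?c"
        using n p(2) by (cases p) (auto simp: length_concat_replicate)
      then have "\<not> prefix ?c r" by (auto dest: prefix_length_le)
      moreover have "\<not> prefix r ?c"
      proof
        assume "prefix r ?c"
        then obtain t where "?c = r @ t" by (auto simp: prefix_def)
        then have "awalk v t w"
          using c step(2) True awalk_append_right_iff by auto
        then show False using hereditaryD[OF Y step(1)] connects_awalk w by blast
      qed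
      ultimately show ?thesis using ghost_path_parallel c step(2) True by blast
    qed (use ghost_path_distinct_start c step(2) in blast)
  qed
  with step.IH show ?case
  proof eventually_elim
    case (elim n)
    then show ?case
      by (simp add: distrib_left scale_mult_right) (simp add: mult.assoc[symmetric])
  qed
qed

subsection \<open>Extracting a vertex from a combination of paths\<close>

text \<open>These are the error terms that accompany a scalar multiple of \<open>V w\<close> when a
  combination of paths is compressed at \<open>w\<close>.\<close>

definition closed_span :: "'v \<Rightarrow> 'a set" where
  "closed_span w = span {path w r | r. r \<noteq> [] \<and> awalk w r w}"

text \<open>If \<open>s\<close> is a prefix of \<open>r @ s\<close>, the remainder is a closed walk
  at \<open>w\<close> with the same length as \<open>r\<close>, hence nonempty; otherwise the term
  vanishes.\<close>

lemma closed_span_conjugate: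
  assumes s: "awalk v s w" and t: "t \<in> closed_span v"
  shows "ghost v s * t * path v s \<in> closed_span w"
  using t unfolding closed_span_def
proof (induction rule: span_induct_alt)
  case base
  show ?case by (simp add: span_zero)
next
  case (step c x y)
  then obtain r where r: "x = path v r" "r \<noteq> []" "awalk v r v" by blast
  have rs: "awalk v (r @ s) w" using r(3) s by (rule awalk_append_trans)
  have x: "ghost v s * x * path v s = ghost v s * path v (r @ s)"
    using path_append[OF r(3) s] r(1) by (simp add: mult.assoc)
  have "ghost v s * x * path v s \<in> span {path w r | r. r \<noteq> [] \<and> awalk w r w}"
  proof (cases "prefix s (r @ s)")
    case True
    then obtain d where d: "r @ s = s @ d" by (auto simp: prefix_def)
    then have "awalk w d w" using rs awalk_append_right_iff[OF s] by simp
    moreover have "length d = length r" using d by (metis add.commute add_left_imp_eq length_append)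
    then have "d \<noteq> []" using r(2) by auto
    moreover have "ghost v s * path v (r @ s) = path w d"
      unfolding d using ghost_path_prefix(1)[OF s \<open>awalk w d w\<close>] .
    ultimately show ?thesis unfolding x by (intro span_base) auto
  next
    case False
    moreover have "\<not> prefix (r @ s) s" using r(2) by (auto dest: prefix_length_le)
    ultimately have "s \<parallel> r @ s" by blast
    then show ?thesis unfolding x using ghost_path_parallel[OF s rs] by (simp add: span_zero)
  qed
  then have "c *s (ghost v s * x * path v s) + ghost v s * y * path v s
      \<in> span {path w r | r. r \<noteq> [] \<and> awalk w r w}"
    using step.IH by (intro span_add span_scale)
  then show ?case
    by (simp add: distrib_left distrib_right scale_mult_left scale_mult_right)
qed

text \<open>A single walk \<open>r\<close> is handled by every \<open>n\<close> with
  \<open>length r \<le> n\<close>, by \<open>CSP_power_shift_parallel\<close>. The filter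
  formulation yields one exponent that serves all terms of \<open>t\<close>.\<close>

lemma closed_span_annihilated:
  assumes p: "p \<in> CSP E w" and q: "q \<in> CSP E w" and "p \<noteq> q" and t: "t \<in> closed_span w"
  shows "\<forall>\<^sub>F n in sequentially. ghost w (concat (replicate n p) @ q) * t
    * path w (concat (replicate n p) @ q) = 0"
  using t unfolding closed_span_def
proof (induction rule: span_induct_alt)
  case base
  show ?case by simp
next
  case (step c x y)
  then obtain r where r: "x = path w r" "r \<noteq> []" "awalk w r w" by blast
  have "\<forall>\<^sub>F n in sequentially. length r \<le> n" by (rule eventually_ge_at_top)
  with step.IH show ?case
  proof eventually_elim
    case (elim n)
    let ?c = "concat (replicate n p) @ q"
    have c: "awalk w ?c w"
      using awalk_append_trans[OF awalk_concat_replicate[OF CSP_awalk[OF p]] CSP_awalk[OF q]] .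
    have rc: "awalk w (r @ ?c) w" using awalk_append_trans[OF r(3) c] .
    have "ghost w ?c * x * path w ?c = ghost w ?c * path w (r @ ?c)"
      using path_append[OF r(3) c] r(1) by (simp add: mult.assoc)
    also have "\<dots> = 0"
      using ghost_path_parallel[OF c rc CSP_power_shift_parallel[OF p q \<open>p \<noteq> q\<close> r(3,2) elim(2)]] .
    finally show ?case using elim(1)
      by (simp add: distrib_left distrib_right scale_mult_left scale_mult_right)
  qed
qed

text \<open>All paths end at the same \<open>v\<close>, so multiplication by the ghost of one of
  them leaves a multiple of \<open>V v\<close> and closed walks at \<open>v\<close>. The result is
  transported to a branching vertex outside \<open>Y\<close>, where the error is removed by
  \<open>closed_span_annihilated\<close>.\<close>

lemma extract_vertex_of_paths:
  assumes G: "finite G" "G \<noteq> {}" and aw: "\<And>u p. (u, p) \<in> G \<Longrightarrow> awalk u p v"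
    and k: "\<And>g. g \<in> G \<Longrightarrow> k g \<noteq> 0"
    and v: "v \<in> P_ppi E" and Y: "hereditary E Y" "saturated E Y" "v \<notin> Y"
  shows "\<exists>x\<in>L. \<exists>y\<in>L. \<exists>w\<in>P_ppi E - Y. branching E w
    \<and> x * (\<Sum>(u, p)\<in>G. k (u, p) *s path u p) * y = V w"
proof -
  \<comment> \<open>Minimal length ensures that no other path of \<open>G\<close> from the same
    start is a prefix of \<open>p0\<close>, so no ghost parts are left over.\<close>
  obtain g0 where g0: "g0 \<in> G" "\<forall>g. g \<in> G \<longrightarrow> length (snd g0) \<le> length (snd g)"
    using ex_has_least_nat[of "\<lambda>g. g \<in> G" _ "\<lambda>g. length (snd g)"] G(2) by blast
  obtain u0 p0 where up: "g0 = (u0, p0)" by (cases g0)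
  have p0: "awalk u0 p0 v" using aw g0(1) up by blast
  define t where "t = ghost u0 p0 * (\<Sum>(u, p)\<in>G - {g0}. k (u, p) *s path u p)"
  have term_closed: "ghost u0 p0 * path u p \<in> closed_span v" if "(u, p) \<in> G - {g0}" for u p
  proof -
    have p: "awalk u p v" using aw that by blast
    show ?thesis
    proof (cases "u = u0 \<and> prefix p0 p")
      case True
      then obtain r where r: "p = p0 @ r" by (auto simp: prefix_def)
      have "r \<noteq> []" using True that up r by auto
      moreover have rr: "awalk v r v" using p True r awalk_append_right_iff[OF p0] by simp
      moreover have "ghost u0 p0 * path u p = path v r"
        using ghost_path_prefix(1)[OF p0 rr] True r by simp
      ultimately show ?thesis unfolding closed_span_def by (intro span_base) auto
    next
      case False
      have "ghost u0 p0 * path u p = 0"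
      proof (cases "u = u0")
        case True
        have "\<not> prefix p p0"
        proof
          assume pre: "prefix p p0"
          have "length p0 \<le> length p" using g0(2) that up by force
          then have "p = p0" using pre by (auto simp: prefix_def)
          then show False using False True by simp
        qed
        then have "p0 \<parallel> p" using False True by blast
        then show ?thesis using ghost_path_parallel[OF p0] p True by blast
      next
        case False
        then show ?thesis using ghost_path_distinct_start[OF p0 p] by simp
      qed
      then show ?thesis unfolding closed_span_def by (simp add: span_zero)
    qed
  qed
  have "t = (\<Sum>(u, p)\<in>G - {g0}. k (u, p) *s (ghost u0 p0 * path u p))"
    unfolding t_def sum_distrib_left by (rule sum.cong) (auto simp: scale_mult_right)
  also have "\<dots> \<in> closed_span v"
    unfolding closed_span_def
    by (rule span_sum) (use term_closed in \<open>auto simp: closed_span_def intro!: span_scale\<close>)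
  finally have t: "t \<in> closed_span v" .
  have "(\<Sum>(u, p)\<in>G. k (u, p) *s path u p)
      = k g0 *s path u0 p0 + (\<Sum>(u, p)\<in>G - {g0}. k (u, p) *s path u p)"
    using sum.remove[OF G(1) g0(1), of "\<lambda>(u, p). k (u, p) *s path u p"] up by simp
  then have eq1: "ghost u0 p0 * (\<Sum>(u, p)\<in>G. k (u, p) *s path u p) = k g0 *s V v + t"
    by (simp add: t_def distrib_left scale_mult_right ghost_path[OF p0])
  have "v \<in> P_pi E" using v P_ppi_subset by blast
  then obtain w where w: "connects E v w" "w \<notin> Y" "branching E w"
    using P_pi_reaches_branching[OF _ Y] by blast
  have wH: "w \<in> P_ppi E" using hereditaryD[OF hereditary_P_ppi v w(1)] .
  obtain s where s: "awalk v s w" using w(1) unfolding connects_def by blast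
  define t' where "t' = ghost v s * t * path v s"
  have t': "t' \<in> closed_span w" unfolding t'_def by (rule closed_span_conjugate[OF s t])
  have eq2: "ghost v s * (k g0 *s V v + t) * path v s = k g0 *s V w + t'"
    unfolding t'_def
    by (simp add: distrib_left distrib_right scale_mult_left scale_mult_right ghost_V[OF s]
        ghost_path[OF s])
  obtain p q where pq: "p \<in> CSP E w" "q \<in> CSP E w" "p \<noteq> q"
    using w(3) unfolding branching_def by blast
  obtain n where n: "ghost w (concat (replicate n p) @ q) * t'
      * path w (concat (replicate n p) @ q) = 0"
    using closed_span_annihilated[OF pq t'] eventually_happens' sequentially_bot by blast
  define c where "c = concat (replicate n p) @ q"
  have c: "awalk w c w" unfolding c_def
    using awalk_append_trans[OF awalk_concat_replicate[OF CSP_awalk[OF pq(1)]] CSP_awalk[OF pq(2)]] .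
  have eq3: "ghost w c * (k g0 *s V w + t') * path w c = k g0 *s V w"
    using n[folded c_def]
    by (simp add: distrib_left distrib_right scale_mult_left scale_mult_right ghost_V[OF c]
        ghost_path[OF c])
  define x where "x = inverse (k g0) *s (ghost w c * ghost v s * ghost u0 p0)"
  define y where "y = path v s * path w c"
  have "x * (\<Sum>(u, p)\<in>G. k (u, p) *s path u p) * y
      = inverse (k g0) *s (ghost w c * (ghost v s
          * (ghost u0 p0 * (\<Sum>(u, p)\<in>G. k (u, p) *s path u p)) * path v s) * path w c)"
    unfolding x_def y_def by (simp add: scale_mult_left mult.assoc)
  also have "\<dots> = V w"
    unfolding eq1 eq2 eq3 using k[OF g0(1)] by simp
  finally have "x * (\<Sum>(u, p)\<in>G. k (u, p) *s path u p) * y = V w" .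
  moreover have "x \<in> L" "y \<in> L"
    unfolding x_def y_def
    by (intro lspan_scale L_mult L_ghost[OF c] L_ghost[OF s] L_ghost[OF p0] L_path[OF c] L_path[OF s])+
  ultimately show ?thesis using wH w(2,3) by blast
qed

subsection \<open>Ideals and their vertices\<close>

definition L_ideal :: "'a set \<Rightarrow> bool" where
  "L_ideal S \<longleftrightarrow> subspace S \<and> (\<forall>a\<in>L. \<forall>b\<in>S. a * b \<in> S \<and> b * a \<in> S)"

lemma L_ideal_mult: "L_ideal S \<Longrightarrow> a \<in> L \<Longrightarrow> b \<in> S \<Longrightarrow> a * b \<in> S"
    "L_ideal S \<Longrightarrow> a \<in> L \<Longrightarrow> b \<in> S \<Longrightarrow> b * a \<in> S"
  unfolding L_ideal_def by blast+

lemma L_ideal_subspace: "L_ideal S \<Longrightarrow> subspace S"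
  unfolding L_ideal_def by blast

definition vertices_in :: "'a set \<Rightarrow> 'v set" where
  "vertices_in S = {v \<in> verts E. V v \<in> S}"

lemma hereditary_vertices_in:
  assumes S: "L_ideal S"
  shows "hereditary E (vertices_in S)"
  unfolding hereditary_def
proof (intro conjI allI impI)
  show "vertices_in S \<subseteq> verts E" unfolding vertices_in_def by blast
  fix v w assume vw: "v \<in> vertices_in S \<and> connects E v w"
  then obtain p where p: "awalk v p w" unfolding connects_def by blast
  have "ghost v p * V v * path v p \<in> S"
    using vw L_ghost[OF p] L_path[OF p] L_ideal_mult[OF S] unfolding vertices_in_def by blast
  then have "V w \<in> S" by (simp add: ghost_V[OF p] ghost_path[OF p])
  then show "w \<in> vertices_in S" using vw connects_verts(2) unfolding vertices_in_def by blast
qed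

lemma X_V_X': "e \<in> arcs E \<Longrightarrow> X e * V (head E e) * X' e = X e * X' e"
  by (simp add: X_head)

lemma saturated_vertices_in:
  assumes S: "L_ideal S"
  shows "saturated E (vertices_in S)"
  unfolding saturated_def
proof (intro conjI allI impI)
  show "vertices_in S \<subseteq> verts E" unfolding vertices_in_def by blast
  fix v assume v: "regular_vertex E v \<and> head E ` out_arcs E v \<subseteq> vertices_in S"
  have mem: "X e * X' e \<in> S" if e: "e \<in> out_arcs E v" for e
  proof -
    have "V (head E e) \<in> S" using v e unfolding vertices_in_def by blast
    then have "X e * V (head E e) * X' e \<in> S"
      using L_ideal_mult[OF S] L_X L_X' e by simp
    then show ?thesis using X_V_X' e by simp
  qed
  have "(\<Sum>e\<in>out_arcs E v. X e * X' e) \<in> S"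
    by (rule subspace_sum[OF L_ideal_subspace[OF S] mem])
  then have "V v \<in> S" using Cuntz_Krieger v by simp
  then show "v \<in> vertices_in S" using v unfolding vertices_in_def regular_vertex_def by blast
qed

section \<open>Explicit combinations of monomials and multiplication by an edge\<close>

lemma span_monomials_explicit:
  assumes "a \<in> span (monomials H n)"
  obtains G k where "finite G"
    "\<And>u p u' q. (u, p, u', q) \<in> G \<Longrightarrow> \<exists>v\<in>H. awalk u p v \<and> awalk u' q v \<and> length q \<le> n"
    "\<And>g. g \<in> G \<Longrightarrow> k g \<noteq> 0"
    "a = (\<Sum>(u, p, u', q)\<in>G. k (u, p, u', q) *s (path u p * ghost u' q))"
proof -
  define m where "m = (\<lambda>(u, p, u', q). path u p * ghost u' q)"
  obtain t r where t: "finite t" "t \<subseteq> monomials H n" "a = (\<Sum>x\<in>t. r x *s x)"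
    using assms unfolding span_explicit by blast
  \<comment> \<open>Zero coefficients are dropped because the extraction of a vertex later divides
    by a coefficient.\<close>
  define t' where "t' = {x \<in> t. r x \<noteq> 0}"
  have a: "a = (\<Sum>x\<in>t'. r x *s x)"
    unfolding t(3) t'_def by (rule sum.mono_neutral_right) (use t in auto)
  define valid where "valid = (\<lambda>(u, p, u', q). \<exists>v\<in>H. awalk u p v \<and> awalk u' q v \<and> length q \<le> n)"
  have "\<forall>x\<in>t'. \<exists>g. m g = x \<and> valid g"
  proof
    fix x assume "x \<in> t'"
    then have "x \<in> monomials H n" using t(2) unfolding t'_def by blast
    then obtain u p u' q v where "x = path u p * ghost u' q" "v \<in> H" "awalk u p v" "awalk u' q v"
      "length q \<le> n"
      unfolding monomials_def by blast
    then show "\<exists>g. m g = x \<and> valid g"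
      by (intro exI[of _ "(u, p, u', q)"]) (auto simp: m_def valid_def)
  qed
  from bchoice[OF this] obtain key where key: "\<forall>x\<in>t'. m (key x) = x \<and> valid (key x)"
    by blast
  show thesis
  proof (rule that[of "key ` t'" "r \<circ> m"])
    \<comment> \<open>Terms are indexed by their paths instead of their values, so that they can be
      sorted by ghost part. As \<open>m\<close> inverts \<open>key\<close>, each value keeps its
      coefficient.\<close>
    have inj: "inj_on key t'" using key by (metis inj_onI)
    have "a = (\<Sum>g\<in>key ` t'. r (m g) *s m g)"
      unfolding a sum.reindex[OF inj] by (rule sum.cong) (auto simp: key)
    then show "a = (\<Sum>(u, p, u', q)\<in>key ` t'. (r \<circ> m) (u, p, u', q) *s (path u p * ghost u' q))"
      by (simp add: m_def case_prod_beta)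
    show "finite (key ` t')" using t(1) unfolding t'_def by simp
    show "\<exists>v\<in>H. awalk u p v \<and> awalk u' q v \<and> length q \<le> n"
      if g: "(u, p, u', q) \<in> key ` t'" for u p u' q
    proof -
      have "valid (u, p, u', q)" using g key by fastforce
      then show ?thesis by (simp add: valid_def)
    qed
    show "(r \<circ> m) g \<noteq> 0" if "g \<in> key ` t'" for g
      using that key unfolding t'_def by auto
  qed
qed

lemma monomial_V:
  assumes "awalk u p w" "awalk u' q w" "v \<in> verts E"
  shows "path u p * ghost u' q * V v = (if u' = v then path u p * ghost u' q else 0)"
proof -
  have "ghost u' q * V v = (if u' = v then ghost u' q else 0)"
    using assms ghost_V[OF assms(2)] ghost_path_distinct_start[OF assms(2), of v "[]" v]
    by (auto simp: awalk_Nil_iff)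
  then show ?thesis by (simp add: mult.assoc)
qed

lemma monomial_X:
  assumes u: "awalk u p w" "awalk (tail E e) q w" and e: "e \<in> arcs E"
  shows "path u p * ghost (tail E e) q * X e =
    (case q of [] \<Rightarrow> path u (p @ [e]) | f # r \<Rightarrow> if f = e then path u p * ghost (head E e) r else 0)"
proof (cases q)
  case Nil
  have w: "w = tail E e" using u(2) Nil by (simp add: awalk_Nil_iff)
  have "awalk w [e] (head E e)" using e w by (simp add: awalk_simps)
  from path_append[OF u(1) this] show ?thesis
    using Nil w e by (simp add: mult.assoc tail_X X_head)
next
  case (Cons f r)
  then have f: "f \<in> arcs E" "awalk (head E f) r w" using u(2) by (auto simp: awalk_simps)
  have "path u p * ghost (tail E e) q * X e = path u p * ghost (head E f) r * (X' f * X e)"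
    using Cons by (simp add: mult.assoc)
  then show ?thesis using Cons f e X'_X[OF f(1) e] ghost_V[OF f(2)] by (auto simp: mult.assoc)
qed

text \<open>A nonempty ghost part loses an edge or the term dies. An empty one stays empty while the
  middle vertex moves along \<open>e\<close>, remaining in \<open>H\<close> by heredity; this is why
  the bound drops to \<open>n\<close> in both cases.\<close>

lemma monomial_X_mem:
  assumes "v \<in> H" "hereditary E H" and u: "awalk u p v" "awalk (tail E e) q v"
    and e: "e \<in> arcs E" and q: "length q \<le> Suc n"
  shows "path u p * ghost (tail E e) q * X e \<in> span (monomials H n)"
proof (cases q)
  case Nil
  have ve: "v = tail E e" using u(2) Nil by (simp add: awalk_Nil_iff)
  have ee: "awalk v [e] (head E e)" using e ve by (simp add: awalk_simps)
  have pe: "awalk u (p @ [e]) (head E e)" using awalk_append_trans[OF u(1) ee] .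
  have "head E e \<in> H" using hereditaryD assms(1,2) connects_awalk[OF ee] by blast
  then have "path u (p @ [e]) * ghost (head E e) [] \<in> monomials H n"
    using pe e by (intro monomialsI[OF _ pe]) (auto simp: awalk_simps)
  then have "path u (p @ [e]) \<in> monomials H n" using path_V[OF pe] by simp
  then show ?thesis using monomial_X[OF u e] Nil by (simp add: span_base)
next
  case (Cons f r)
  then have f: "f \<in> arcs E" "awalk (head E f) r v" using u(2) by (auto simp: awalk_simps)
  show ?thesis
  proof (cases "f = e")
    case True
    have "path u p * ghost (head E f) r \<in> monomials H n"
      using monomialsI[OF assms(1) u(1) f(2)] Cons q by simp
    then show ?thesis using monomial_X[OF u e] Cons True by (simp add: span_base)
  next
    case False
    then show ?thesis using monomial_X[OF u e] Cons by (simp add: span_zero)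
  qed
qed

lemma span_monomials_L: "H \<subseteq> verts E \<Longrightarrow> span (monomials H n) \<subseteq> L"
  unfolding lspan_def monomials_def by (intro span_mono) blast

section \<open>The dichotomy between membership in an ideal and exposure of a vertex outside
  it\<close>

definition exposes :: "'a set \<Rightarrow> 'a \<Rightarrow> bool" where
  "exposes S a \<longleftrightarrow> (\<exists>x\<in>L. \<exists>y\<in>L. \<exists>w\<in>P_ppi E - vertices_in S. branching E w \<and> x * a * y = V w)"

lemma exposes_mult_right:
  assumes "exposes S (a * b)" "b \<in> L"
  shows "exposes S a"
proof -
  obtain x y w where w: "x \<in> L" "y \<in> L" "w \<in> P_ppi E - vertices_in S" "branching E w"
    "x * (a * b) * y = V w"
    using assms(1) unfolding exposes_def by blast
  have "x * a * (b * y) = V w" using w(5) by (simp add: mult.assoc)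
  then show ?thesis unfolding exposes_def using w(1,3,4) L_mult[OF assms(2) w(2)] by blast
qed

lemma mem_ideal_if_corners:
  assumes S: "L_ideal S" and a: "a = (\<Sum>e\<in>F. a * X e * X' e)"
    and F: "F \<subseteq> arcs E" and mem: "\<And>e. e \<in> F \<Longrightarrow> a * X e \<in> S"
  shows "a \<in> S"
proof -
  have "(\<Sum>e\<in>F. a * X e * X' e) \<in> S"
    by (rule subspace_sum[OF L_ideal_subspace[OF S]])
      (use mem F L_ideal_mult[OF S] L_X' in blast)
  then show ?thesis using a by simp
qed

text \<open>This is the induction step for an element with \<open>a * V v = a\<close>. It suffices
  to have finitely many edges for which the sum of \<open>X e * X' e\<close> fixes \<open>a\<close>
  from the right, since \<open>IH\<close> puts every \<open>a * X e\<close> into \<open>S\<close>.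
  Such edges exist at a regular vertex, and also if every term has a nonempty ghost part. In the
  remaining cases, pure paths alone at \<open>n = 0\<close> and pure paths at a nonregular vertex,
  \<open>extract_vertex_of_paths\<close> contradicts non-exposure.\<close>

lemma corner_mem_or_exposes:
  assumes S: "L_ideal S" and nexp: "\<not> exposes S a"
    and fin: "finite G"
    and G: "\<And>u p u' q. (u, p, u', q) \<in> G
      \<Longrightarrow> \<exists>v\<in>P_ppi E. awalk u p v \<and> awalk u' q v \<and> length q \<le> n"
    and k: "\<And>g. g \<in> G \<Longrightarrow> k g \<noteq> 0"
    and a: "a = (\<Sum>(u, p, u', q)\<in>G. k (u, p, u', q) *s (path u p * ghost u' q))"
    and start: "\<And>u p u' q. (u, p, u', q) \<in> G \<Longrightarrow> u' = v"
    and v: "v \<in> verts E" "V v \<notin> S"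
    and IH: "\<And>b m. n = Suc m \<Longrightarrow> b \<in> span (monomials (P_ppi E) m) \<Longrightarrow> \<not> exposes S b \<Longrightarrow> b \<in> S"
  shows "a \<in> S"
proof -
  let ?Y = "vertices_in S"
  have Y: "hereditary E ?Y" "saturated E ?Y" "v \<notin> ?Y"
    using hereditary_vertices_in[OF S] saturated_vertices_in[OF S] v unfolding vertices_in_def
    by auto
  define R where "R = {(u, p). (u, p, v, []) \<in> G}"
  have finR: "finite R"
  proof -
    have "R \<subseteq> (\<lambda>(u, p, u', q). (u, p)) ` G" unfolding R_def by force
    then show ?thesis using fin finite_surj by blast
  qed
  have Raw: "awalk u p v" "v \<in> P_ppi E" if "(u, p) \<in> R" for u p
    using G[of u p v "[]"] that unfolding R_def by (auto simp: awalk_Nil_iff)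
  define N where "N = {(u, p, u', q) \<in> G. q \<noteq> []}"
  define F where "F = (\<lambda>(u, p, u', q). hd q) ` N"
  have finN: "finite N" unfolding N_def using fin by (rule rev_finite_subset) auto
  have G_split: "G = (\<lambda>(u, p). (u, p, v, [])) ` R \<union> N"
    using start unfolding R_def N_def by force
  have aL: "a \<in> L"
  proof -
    have "path u p * ghost u' q \<in> L" if "(u, p, u', q) \<in> G" for u p u' q
      using G[OF that] lspan_monomial[of _ "verts E"] awalk_last_in_verts by blast
    then show ?thesis unfolding a by (intro lspan_sum) (auto intro: lspan_scale)
  qed
  have a_split: "a = (\<Sum>(u, p)\<in>R. k (u, p, v, []) *s path u p)
      + (\<Sum>(u, p, u', q)\<in>N. k (u, p, u', q) *s (path u p * ghost u' q))"
  proof -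
    have "(\<Sum>(u, p, u', q)\<in>(\<lambda>(u, p). (u, p, v, [])) ` R. k (u, p, u', q) *s (path u p * ghost u' q))
        = (\<Sum>(u, p)\<in>R. k (u, p, v, []) *s path u p)"
      by (subst sum.reindex) (auto simp: inj_on_def path_V[OF Raw(1)] intro!: sum.cong)
    moreover have disj: "(\<lambda>(u, p). (u, p, v, [])) ` R \<inter> N = {}" unfolding N_def by auto
    ultimately show ?thesis
      unfolding a
      by (subst G_split) (simp only: sum.union_disjoint[OF finite_imageI[OF finR] finN disj])
  qed
  have aX: "a * X e = (\<Sum>(u, p, u', q)\<in>G. k (u, p, u', q) *s (path u p * ghost u' q * X e))" for e
    unfolding a sum_distrib_right by (intro sum.cong) (auto simp: scale_mult_left)
  have nexpX: "\<not> exposes S (a * X e)" if "e \<in> arcs E" for e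
    using exposes_mult_right[OF _ L_X[OF that]] nexp by blast
  have corner: "a * X e \<in> S" if e: "e \<in> arcs E" "tail E e = v" and n: "n = Suc m" for e m
  proof (rule IH[OF n _ nexpX[OF e(1)]])
    have "path u p * ghost u' q * X e \<in> span (monomials (P_ppi E) m)" if g: "(u, p, u', q) \<in> G" for u p u' q
    proof -
      obtain w where w: "w \<in> P_ppi E" "awalk u p w" "awalk u' q w" "length q \<le> n"
        using G[OF g] by blast
      have "u' = tail E e" using start[OF g] e by simp
      then show ?thesis
        using monomial_X_mem[OF w(1) hereditary_P_ppi w(2) _ e(1)] w(3,4) n by simp
    qed
    then show "a * X e \<in> span (monomials (P_ppi E) m)"
      unfolding aX by (intro span_sum) (auto intro: span_scale)
  qed
  have Nempty: "N = {}" if "n = 0"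
    using G that unfolding N_def by fastforce
  have exposes_R: "exposes S a" if "R \<noteq> {}" "N = {}"
  proof -
    have aR: "a = (\<Sum>(u, p)\<in>R. k (u, p, v, []) *s path u p)" using a_split that by simp
    have vH: "v \<in> P_ppi E" using Raw that by auto
    define kR where "kR = (\<lambda>(u, p). k (u, p, v, []))"
    have kR: "kR g \<noteq> 0" if "g \<in> R" for g
      using k that unfolding R_def kR_def by auto
    have "a = (\<Sum>(u, p)\<in>R. kR (u, p) *s path u p)" unfolding aR kR_def by simp
    then show ?thesis
      using extract_vertex_of_paths[where k = kR, OF finR that(1) Raw(1) kR vH Y]
      unfolding exposes_def by simp
  qed
  show ?thesis
  proof (cases n)
    case 0
    then have "R = {}" using exposes_R Nempty nexp by blast
    then show ?thesis using a_split Nempty[OF 0] subspace_0[OF L_ideal_subspace[OF S]] by simp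
  next
    case n: (Suc m)
    have av: "a * V v = a"
    proof -
      have "path u p * ghost u' q * V v = path u p * ghost u' q" if g: "(u, p, u', q) \<in> G" for u p u' q
        using G[OF g] monomial_V v start[OF g] by auto
      then show ?thesis unfolding a sum_distrib_right
        by (intro sum.cong) (auto simp: scale_mult_left)
    qed
    show ?thesis
    proof (cases "regular_vertex E v")
      case True
      have "a = (\<Sum>e\<in>out_arcs E v. a * X e * X' e)"
        using av Cuntz_Krieger[OF True] by (metis (no_types, lifting) mult.assoc sum.cong sum_distrib_left)
      then show ?thesis
        by (rule mem_ideal_if_corners[OF S]) (use corner n in auto)
    next
      case nonreg: False
      show ?thesis
      proof (cases "R = {}")
        case False
        then have vH: "v \<in> P_ppi E" using Raw by auto
        \<comment> \<open>An edge outside \<open>F\<close> kills every term with a ghost part and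
          prolongs the pure paths, whose new end can be chosen outside \<open>?Y\<close>.\<close>
        have "infinite ({e \<in> out_arcs E v. head E e \<in> verts E - ?Y} - F)"
          using P_ppi_nonregular_emits_infinitely[OF vH nonreg Y] finN unfolding F_def
          by (simp add: Diff_infinite_finite)
        then have "{e \<in> out_arcs E v. head E e \<in> verts E - ?Y} - F \<noteq> {}"
          by (rule infinite_imp_nonempty)
        then obtain e where "e \<in> out_arcs E v" "head E e \<notin> ?Y" "e \<notin> F" by blast
        then have e: "e \<in> arcs E" "tail E e = v" "head E e \<notin> ?Y" "e \<notin> F" by simp_all
        have ve: "awalk v [e] (head E e)" using e by (auto simp: awalk_simps)
        have eH: "head E e \<in> P_ppi E"
          using hereditaryD[OF hereditary_P_ppi vH] connects_awalk[OF ve] by blast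
        define R' where "R' = (\<lambda>(u, p). (u, p @ [e])) ` R"
        \<comment> \<open>\<open>butlast\<close> recovers the original path, so the coefficients
          carry over and stay nonzero.\<close>
        define k' where "k' = (\<lambda>(u, p). k (u, butlast p, v, []))"
        have R'aw: "awalk u p (head E e)" if "(u, p) \<in> R'" for u p
        proof -
          obtain p' where "p = p' @ [e]" "(u, p') \<in> R" using \<open>(u, p) \<in> R'\<close> unfolding R'_def by auto
          then show ?thesis using awalk_append_trans[OF Raw(1) ve] by blast
        qed
        have k': "k' g \<noteq> 0" if "g \<in> R'" for g
          using that k unfolding R'_def k'_def R_def by auto
        have N0: "path u p * ghost u' q * X e = 0" if g: "(u, p, u', q) \<in> N" for u p u' q
        proof -
          have gG: "(u, p, u', q) \<in> G" and "q \<noteq> []" using g unfolding N_def by auto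
          then obtain f r where q: "q = f # r" by (cases q) auto
          have "f \<in> F" using g q unfolding F_def by force
          then have "f \<noteq> e" using e by auto
          obtain w where w: "awalk u p w" "awalk u' q w" using G[OF gG] by blast
          have u': "u' = tail E e" using start[OF gG] e by simp
          show ?thesis
            using monomial_X[OF w(1) w(2)[unfolded u'] e(1)] q \<open>f \<noteq> e\<close>
            by (simp add: u' del: ghost.simps)
        qed
        have PX: "path u p * X e = path u (p @ [e])" if "(u, p) \<in> R" for u p
          using path_append[OF Raw(1)[OF that] ve] e by (simp add: X_head tail_X)
        have "a * X e = (\<Sum>(u, p)\<in>R. k (u, p, v, []) *s (path u p * X e))
            + (\<Sum>(u, p, u', q)\<in>N. k (u, p, u', q) *s (path u p * ghost u' q * X e))"
          unfolding a_split distrib_right sum_distrib_right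
          by (intro arg_cong2[where f = "(+)"] sum.cong) (auto simp: scale_mult_left)
        also have "(\<Sum>(u, p, u', q)\<in>N. k (u, p, u', q) *s (path u p * ghost u' q * X e)) = 0"
          by (rule sum.neutral) (auto simp: N0)
        also have "(\<Sum>(u, p)\<in>R. k (u, p, v, []) *s (path u p * X e)) + 0
            = (\<Sum>(u, p)\<in>R'. k' (u, p) *s path u p)"
          unfolding R'_def k'_def
          by (subst sum.reindex) (auto simp: inj_on_def PX intro!: sum.cong)
        finally have "a * X e = (\<Sum>(u, p)\<in>R'. k' (u, p) *s path u p)" .
        moreover have "finite R'" "R' \<noteq> {}" using finR False unfolding R'_def by auto
        ultimately have "exposes S (a * X e)"
          using extract_vertex_of_paths[where k = k', OF _ _ R'aw k' eH Y(1,2) e(3)] unfolding exposes_def by simp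
        then show ?thesis using nexpX[OF e(1)] by blast
      next
        case True
        have FA: "f \<in> arcs E \<and> tail E f = v" if f: "f \<in> F" for f
        proof -
          obtain u p u' q where g: "(u, p, u', q) \<in> N" "f = hd q"
            using f unfolding F_def by auto
          then have gG: "(u, p, u', q) \<in> G" and "q \<noteq> []" unfolding N_def by auto
          then obtain r where "q = f # r" using g by (cases q) auto
          then show ?thesis using G[OF gG] start[OF gG] by (auto simp: awalk_simps)
        qed
        have finF: "finite F" unfolding F_def using finN by simp
        \<comment> \<open>Every ghost part begins with an edge in \<open>F\<close>, so the finite
          sum over \<open>F\<close> is a right identity for the terms in \<open>N\<close> and takes
          over the role of the Cuntz-Krieger relation.\<close>
        have fix_: "path u p * ghost u' q * (\<Sum>e\<in>F. X e * X' e) = path u p * ghost u' q"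
          if g: "(u, p, u', q) \<in> N" for u p u' q
        proof -
          have gG: "(u, p, u', q) \<in> G" and "q \<noteq> []" using g unfolding N_def by auto
          then obtain f r where q: "q = f # r" by (cases q) auto
          have fF: "f \<in> F" using g q unfolding F_def by force
          have "X' f * (\<Sum>e\<in>F. X e * X' e) = (\<Sum>e\<in>F. if e = f then X' f else 0)"
            unfolding sum_distrib_left
            by (rule sum.cong) (use FA fF in \<open>auto simp: X'_X head_X' mult.assoc[symmetric]\<close>)
          also have "\<dots> = X' f" using fF finF by simp
          finally show ?thesis unfolding q by (simp add: mult.assoc)
        qed
        have aN: "a = (\<Sum>(u, p, u', q)\<in>N. k (u, p, u', q) *s (path u p * ghost u' q))"
          using a_split True by simp
        have "a = a * (\<Sum>e\<in>F. X e * X' e)"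
          unfolding aN sum_distrib_right by (rule sum.cong) (auto simp: scale_mult_left fix_)
        then have "a = (\<Sum>e\<in>F. a * X e * X' e)" by (simp add: sum_distrib_left mult.assoc)
        then show ?thesis
          by (rule mem_ideal_if_corners[OF S]) (use FA corner n in auto)
      qed
    qed
  qed
qed

text \<open>Sorting the terms by the start of their ghost parts makes \<open>a\<close> the sum of
  finitely many corners \<open>a * V v\<close>. A corner with \<open>V v\<close> in \<open>S\<close>
  lies in \<open>S\<close>; the others inherit non-exposure from \<open>a\<close> and fall under
  \<open>corner_mem_or_exposes\<close>.\<close>

lemma mem_or_exposes:
  assumes S: "L_ideal S" and "a \<in> span (monomials (P_ppi E) n)" and "\<not> exposes S a"
  shows "a \<in> S"
  using assms(2,3)
proof (induction n arbitrary: a rule: less_induct)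
  case (less n)
  obtain G k where fin: "finite G"
    and G: "\<And>u p u' q. (u, p, u', q) \<in> G
      \<Longrightarrow> \<exists>v\<in>P_ppi E. awalk u p v \<and> awalk u' q v \<and> length q \<le> n"
    and k: "\<And>g. g \<in> G \<Longrightarrow> k g \<noteq> 0"
    and a: "a = (\<Sum>(u, p, u', q)\<in>G. k (u, p, u', q) *s (path u p * ghost u' q))"
    by (rule span_monomials_explicit[OF less.prems(1)]) (rule that)
  define U where "U = (\<lambda>(u, p, u', q). u') ` G"
  have finU: "finite U" unfolding U_def using fin by simp
  have U: "v \<in> verts E" if "v \<in> U" for v
    using that G awalk_hd_in_verts unfolding U_def by fastforce
  have corner: "a * V v = (\<Sum>(u, p, u', q)\<in>{(u, p, u', q) \<in> G. u' = v}.
      k (u, p, u', q) *s (path u p * ghost u' q))" if "v \<in> verts E" for v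
  proof -
    have "a * V v = (\<Sum>(u, p, u', q)\<in>G. if u' = v then k (u, p, u', q) *s (path u p * ghost u' q) else 0)"
      unfolding a sum_distrib_right
    proof (rule sum.cong[OF refl])
      fix g assume g: "g \<in> G"
      obtain u p u' q where gg: "g = (u, p, u', q)" by (cases g)
      then obtain w where "awalk u p w" "awalk u' q w" using G g by blast
      from monomial_V[OF this that]
      show "(case g of (u, p, u', q) \<Rightarrow> k (u, p, u', q) *s (path u p * ghost u' q)) * V v
        = (case g of (u, p, u', q) \<Rightarrow> if u' = v then k (u, p, u', q) *s (path u p * ghost u' q) else 0)"
        by (simp add: gg scale_mult_left)
    qed
    also have "\<dots> = (\<Sum>g\<in>G. if g \<in> {(u, p, u', q). u' = v}
        then (case g of (u, p, u', q) \<Rightarrow> k (u, p, u', q) *s (path u p * ghost u' q)) else 0)"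
      by (rule sum.cong) auto
    also have "\<dots> = (\<Sum>g\<in>G \<inter> {(u, p, u', q). u' = v}.
        (case g of (u, p, u', q) \<Rightarrow> k (u, p, u', q) *s (path u p * ghost u' q)))"
      by (rule sum.inter_restrict[OF fin, symmetric])
    also have "G \<inter> {(u, p, u', q). u' = v} = {(u, p, u', q) \<in> G. u' = v}" by auto
    finally show ?thesis .
  qed
  have fixU: "path u p * ghost u' q * (\<Sum>v\<in>U. V v) = path u p * ghost u' q"
    if g: "(u, p, u', q) \<in> G" for u p u' q
  proof -
    have "u' \<in> U" using g unfolding U_def by force
    obtain w where w: "awalk u p w" "awalk u' q w" using G[OF g] by blast
    have "path u p * ghost u' q * (\<Sum>v\<in>U. V v)
        = (\<Sum>v\<in>U. if u' = v then path u p * ghost u' q else 0)"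
      unfolding sum_distrib_left by (rule sum.cong) (simp_all add: monomial_V[OF w] U)
    then show ?thesis using \<open>u' \<in> U\<close> finU by simp
  qed
  have "a = a * (\<Sum>v\<in>U. V v)"
    unfolding a sum_distrib_right by (rule sum.cong) (auto simp: scale_mult_left fixU)
  then have decomp: "a = (\<Sum>v\<in>U. a * V v)" by (simp add: sum_distrib_left)
  have aL: "a \<in> L"
    using less.prems(1) span_monomials_L[OF hereditary_subset[OF hereditary_P_ppi]] by blast
  have mem: "a * V v \<in> S" if v: "v \<in> U" for v
  proof (cases "V v \<in> S")
    case True
    then show ?thesis using L_ideal_mult(1)[OF S aL] by blast
  next
    case False
    have nexp: "\<not> exposes S (a * V v)"
      using exposes_mult_right[OF _ L_V[OF U[OF v]]] less.prems(2) by blast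
    show ?thesis
    proof (rule corner_mem_or_exposes[OF S nexp _ _ _ corner[OF U[OF v]] _ U[OF v] False])
      show "finite {(u, p, u', q) \<in> G. u' = v}" using fin by (rule rev_finite_subset) auto
      show "\<exists>v\<in>P_ppi E. awalk u p v \<and> awalk u' q v \<and> length q \<le> n"
        if "(u, p, u', q) \<in> {(u, p, u', q) \<in> G. u' = v}" for u p u' q
        using that G by blast
      show "b \<in> S" if "n = Suc m" "b \<in> span (monomials (P_ppi E) m)" "\<not> exposes S b" for b m
        using less.IH[of m b] that by simp
    qed (use k in auto)
  qed
  have "(\<Sum>v\<in>U. a * V v) \<in> S"
    by (rule subspace_sum[OF L_ideal_subspace[OF S] mem])
  then show ?case using decomp by simp
qed

end

text \<open>Reachability is only a preorder, so one representative is kept for mutually reachable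
  vertices. A new vertex \<open>b\<close> that is not yet reached replaces all chosen vertices that
  it reaches.\<close>

lemma (in wf_digraph) maximal_antichain:
  assumes "finite B" "B \<subseteq> verts G"
  shows "\<exists>W\<subseteq>B. (\<forall>w\<in>W. \<forall>w'\<in>W. connects G w w' \<longrightarrow> w = w') \<and> (\<forall>b\<in>B. \<exists>w\<in>W. connects G w b)"
  using assms
proof (induction B rule: finite_induct)
  case empty
  then show ?case by simp
next
  case (insert b B)
  then obtain W where W: "W \<subseteq> B" "\<forall>w\<in>W. \<forall>w'\<in>W. connects G w w' \<longrightarrow> w = w'"
    "\<forall>b\<in>B. \<exists>w\<in>W. connects G w b" by auto
  show ?case
  proof (cases "\<exists>w\<in>W. connects G w b")
    case True
    then show ?thesis using W by (intro exI[of _ W]) blast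
  next
    case False
    define W' where "W' = insert b {w \<in> W. \<not> connects G b w}"
    have "W' \<subseteq> insert b B" unfolding W'_def using W(1) by blast
    moreover have "\<forall>w\<in>W'. \<forall>w'\<in>W'. connects G w w' \<longrightarrow> w = w'"
      unfolding W'_def using W(2) False by blast
    moreover have "\<exists>w\<in>W'. connects G w x" if x: "x \<in> insert b B" for x
    proof (cases "x = b")
      case True
      then show ?thesis unfolding W'_def using connects_refl insert.prems by blast
    next
      case False
      then obtain w where w: "w \<in> W" "connects G w x" using x W(3) by blast
      show ?thesis
      proof (cases "connects G b w")
        case True
        then show ?thesis unfolding W'_def using connects_trans[OF True w(2)] by blast
      next
        case False
        then show ?thesis unfolding W'_def using w by blast
      qed
    qed
    ultimately show ?thesis by (intro exI[of _ W']) simp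
  qed
qed

context leavitt_family
begin

subsection \<open>The ideal generated by an element of \<open>I(P\<^sub>p\<^sub>p\<^sub>i)\<close>\<close>

definition exposed :: "'a \<Rightarrow> 'v set" where
  "exposed a = {w \<in> P_ppi E. branching E w \<and> (\<exists>x\<in>L. \<exists>y\<in>L. x * a * y = V w)}"

definition exposed_ideal :: "'a \<Rightarrow> 'a set" where
  "exposed_ideal a = span {c * V w * d | c w d. c \<in> L \<and> w \<in> exposed a \<and> d \<in> L}"

lemma exposed_verts: "w \<in> exposed a \<Longrightarrow> w \<in> verts E"
  unfolding exposed_def using branching_verts by blast

lemma L_ideal_exposed_ideal: "L_ideal (exposed_ideal a)"
  unfolding L_ideal_def
proof (intro conjI ballI)
  show "subspace (exposed_ideal a)" unfolding exposed_ideal_def by (rule subspace_span)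
  fix x b assume x: "x \<in> L" and b: "b \<in> exposed_ideal a"
  let ?B = "{c * V w * d | c w d. c \<in> L \<and> w \<in> exposed a \<and> d \<in> L}"
  show "x * b \<in> exposed_ideal a"
    using b unfolding exposed_ideal_def
  proof (induction rule: span_induct_alt)
    case base
    show ?case by (simp add: span_zero)
  next
    case (step r z y)
    then obtain c w d where z: "z = c * V w * d" "c \<in> L" "w \<in> exposed a" "d \<in> L" by blast
    have "x * z = (x * c) * V w * d" by (simp add: z mult.assoc)
    then have "x * z \<in> ?B" using z L_mult[OF x z(2)] by blast
    then show ?case using step.IH
      by (simp add: distrib_left scale_mult_right span_add span_scale span_base)
  qed
  show "b * x \<in> exposed_ideal a"
    using b unfolding exposed_ideal_def
  proof (induction rule: span_induct_alt)
    case base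
    show ?case by (simp add: span_zero)
  next
    case (step r z y)
    then obtain c w d where z: "z = c * V w * d" "c \<in> L" "w \<in> exposed a" "d \<in> L" by blast
    have "z * x = c * V w * (d * x)" by (simp add: z mult.assoc)
    then have "z * x \<in> ?B" using z L_mult[OF z(4) x] by blast
    then show ?case using step.IH
      by (simp add: distrib_right scale_mult_left span_add span_scale span_base)
  qed
qed

lemma lspan_bounded: "a \<in> lspan H \<Longrightarrow> \<exists>n. a \<in> span (monomials H n)"
proof (induction rule: lspan_induct)
  case zero
  show ?case by (simp add: span_zero)
next
  case (step c u p u' q v a)
  then obtain n where n: "a \<in> span (monomials H n)" by blast
  have mono: "monomials H n \<subseteq> monomials H (max n (length q))"
    unfolding monomials_def by force
  have "path u p * ghost u' q \<in> monomials H (max n (length q))"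
    using step by (intro monomialsI) auto
  moreover have "a \<in> span (monomials H (max n (length q)))"
    using n span_mono[OF mono] by blast
  ultimately show ?case by (blast intro: span_add span_scale span_base)
qed

text \<open>The dichotomy is applied to the exposed ideal itself: a vertex exposed outside it would
  be one of its own generators.\<close>

lemma mem_exposed_ideal:
  assumes "a \<in> lspan (P_ppi E)"
  shows "a \<in> exposed_ideal a"
proof (rule ccontr)
  assume "a \<notin> exposed_ideal a"
  moreover obtain n where "a \<in> span (monomials (P_ppi E) n)" using lspan_bounded[OF assms] by blast
  ultimately have "exposes (exposed_ideal a) a"
    using mem_or_exposes[OF L_ideal_exposed_ideal] by blast
  then obtain w where w: "w \<in> exposed a" "w \<notin> vertices_in (exposed_ideal a)"
    unfolding exposes_def exposed_def by blast
  have wv: "w \<in> verts E" using exposed_verts[OF w(1)] .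
  \<comment> \<open>This has the shape \<open>c * V w * d\<close> of a generator; \<open>L\<close>
    need not contain a unit.\<close>
  have "V w * V w * V w \<in> exposed_ideal a"
    unfolding exposed_ideal_def using w(1) L_V[OF wv] by (intro span_base) blast
  then show False using w(2) wv by (simp add: V_V vertices_in_def)
qed

subsection \<open>Orthogonal copies\<close>

text \<open>A cross term for \<open>w\<close> and \<open>w'\<close> lies in the ideal of
  \<open>tree E w'\<close>, which avoids \<open>w\<close>, so \<open>ghost_power_annihilates\<close>
  applies on the left. One exponent serves all of the finitely many pairs, and the matching path on
  the right restores the diagonal.\<close>

lemma orthogonalize_antichain:
  assumes a: "a \<in> L" and W: "finite W" "W \<subseteq> exposed a"
    and anti: "\<forall>w\<in>W. \<forall>w'\<in>W. connects E w w' \<longrightarrow> w = w'"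
  obtains x y where "\<And>w. w \<in> W \<Longrightarrow> x w \<in> L" "\<And>w. w \<in> W \<Longrightarrow> y w \<in> L"
    "\<And>w w'. w \<in> W \<Longrightarrow> w' \<in> W \<Longrightarrow> x w * a * y w' = (if w = w' then V w else 0)"
proof -
  have "\<forall>w\<in>W. \<exists>xy. fst xy \<in> L \<and> snd xy \<in> L \<and> fst xy * a * snd xy = V w"
    using W(2) unfolding exposed_def by force
  from bchoice[OF this] obtain xy where xy:
    "\<forall>w\<in>W. fst (xy w) \<in> L \<and> snd (xy w) \<in> L \<and> fst (xy w) * a * snd (xy w) = V w" by blast
  have "\<forall>w\<in>W. \<exists>p. p \<in> CSP E w" using W(2) unfolding exposed_def branching_def by blast
  from bchoice[OF this] obtain p where p: "\<forall>w\<in>W. p w \<in> CSP E w" by blast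
  \<comment> \<open>Cutting by \<open>V w\<close> on the outer sides leaves the diagonal products
    unchanged, and the right factor of \<open>y1\<close> puts every cross term into the ideal of a
    tree.\<close>
  define x1 where "x1 w = V w * fst (xy w)" for w
  define y1 where "y1 w = snd (xy w) * V w" for w
  have verts: "w \<in> verts E" if "w \<in> W" for w using that W(2) exposed_verts by blast
  have x1: "x1 w \<in> L" "y1 w \<in> L" if "w \<in> W" for w
    unfolding x1_def y1_def using that xy verts by (auto intro: L_mult L_V)
  have diag: "x1 w * a * y1 w = V w" if "w \<in> W" for w
  proof -
    have "x1 w * a * y1 w = V w * (fst (xy w) * a * snd (xy w)) * V w"
      unfolding x1_def y1_def by (simp add: mult.assoc)
    then show ?thesis using xy that verts by (simp add: V_V)
  qed
  have "\<forall>\<^sub>F n in sequentially. ghost w (concat (replicate n (p w))) * (x1 w * a * y1 w') = 0"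
    if w: "w \<in> W" "w' \<in> W" "w \<noteq> w'" for w w'
  proof (rule ghost_power_annihilates[OF hereditary_tree[of w']])
    show "w \<notin> tree E w'" using tree_iff anti w by blast
    show "awalk w (p w) w" "p w \<noteq> []" using p w CSP_awalk CSP_nonempty by blast+
    have "V w' \<in> lspan (tree E w')"
      using verts[OF w(2)] tree_iff connects_refl by (intro lspan_V) auto
    then have "y1 w' \<in> lspan (tree E w')"
      unfolding y1_def using xy w by (intro lspan_mult_left hereditary_tree) auto
    then show "x1 w * a * y1 w' \<in> lspan (tree E w')"
      using x1 w a by (intro lspan_mult_left[OF hereditary_tree] L_mult)
  qed
  then have "\<forall>\<^sub>F n in sequentially. \<forall>g\<in>{(w, w'). w \<in> W \<and> w' \<in> W \<and> w \<noteq> w'}.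
      ghost (fst g) (concat (replicate n (p (fst g)))) * (x1 (fst g) * a * y1 (snd g)) = 0"
    using finite_subset[of "{(w, w'). w \<in> W \<and> w' \<in> W \<and> w \<noteq> w'}" "W \<times> W"] W(1)
    by (intro eventually_ball_finite) auto
  then obtain n where n: "\<forall>g\<in>{(w, w'). w \<in> W \<and> w' \<in> W \<and> w \<noteq> w'}.
      ghost (fst g) (concat (replicate n (p (fst g)))) * (x1 (fst g) * a * y1 (snd g)) = 0"
    using eventually_happens' sequentially_bot by blast
  define c where "c w = concat (replicate n (p w))" for w
  have c: "awalk w (c w) w" if "w \<in> W" for w
    unfolding c_def using awalk_concat_replicate CSP_awalk p that by blast
  show thesis
  proof (rule that[of "\<lambda>w. ghost w (c w) * x1 w" "\<lambda>w. y1 w * path w (c w)"])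
    fix w assume w: "w \<in> W"
    show "ghost w (c w) * x1 w \<in> L" using L_mult[OF L_ghost[OF c[OF w]] x1(1)[OF w]] .
    show "y1 w * path w (c w) \<in> L" using L_mult[OF x1(2)[OF w] L_path[OF c[OF w]]] .
    fix w' assume w': "w' \<in> W"
    have eq: "ghost w (c w) * x1 w * a * (y1 w' * path w' (c w'))
        = ghost w (c w) * (x1 w * a * y1 w') * path w' (c w')"
      by (simp add: mult.assoc)
    show "ghost w (c w) * x1 w * a * (y1 w' * path w' (c w')) = (if w = w' then V w else 0)"
    proof (cases "w = w'")
      case True
      then show ?thesis
        unfolding eq using diag[OF w] c[OF w] ghost_V ghost_path by simp
    next
      case False
      then have "ghost w (c w) * (x1 w * a * y1 w') = 0"
        unfolding c_def using n w w' by auto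
      then show ?thesis unfolding eq using False by simp
    qed
  qed
qed

text \<open>The family is indexed, because several summands of one element may involve the same
  vertex. Each \<open>w i\<close> is reached from some \<open>m i\<close> in an antichain: distinct
  \<open>m i\<close> are already orthogonal, and \<open>s i\<close> carries \<open>m i\<close> to
  \<open>w i\<close>.\<close>

lemma orthogonal_copies:
  assumes a: "a \<in> L" and I: "finite I" and w: "\<And>i. i \<in> I \<Longrightarrow> w i \<in> exposed a"
  obtains x y where "\<And>i. i \<in> I \<Longrightarrow> x i \<in> L" "\<And>i. i \<in> I \<Longrightarrow> y i \<in> L"
    "\<And>i j. i \<in> I \<Longrightarrow> j \<in> I \<Longrightarrow> x i * a * y j = (if i = j then V (w i) else 0)"
proof -
  have "w ` I \<subseteq> verts E" using w exposed_verts by blast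
  from maximal_antichain[OF finite_imageI[OF I] this] obtain W where W: "W \<subseteq> w ` I"
    "\<forall>w\<in>W. \<forall>w'\<in>W. connects E w w' \<longrightarrow> w = w'" "\<forall>b\<in>w ` I. \<exists>w\<in>W. connects E w b"
    by blast
  have finW: "finite W" using W(1) I finite_surj by blast
  have Wexp: "W \<subseteq> exposed a" using W(1) w by blast
  obtain x0 y0 where x0: "\<And>w. w \<in> W \<Longrightarrow> x0 w \<in> L" "\<And>w. w \<in> W \<Longrightarrow> y0 w \<in> L"
    "\<And>w w'. w \<in> W \<Longrightarrow> w' \<in> W \<Longrightarrow> x0 w * a * y0 w' = (if w = w' then V w else 0)"
    by (rule orthogonalize_antichain[OF a finW Wexp W(2)]) (rule that)
  have "\<forall>i\<in>I. \<exists>ms. fst ms \<in> W \<and> awalk (fst ms) (snd ms) (w i)"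
    using W(3) unfolding connects_def by force
  from bchoice[OF this] obtain ms where ms: "\<forall>i\<in>I. fst (ms i) \<in> W \<and> awalk (fst (ms i)) (snd (ms i)) (w i)"
    by blast
  define m where "m i = fst (ms i)" for i
  define s where "s i = snd (ms i)" for i
  have m: "m i \<in> W" and s: "awalk (m i) (s i) (w i)" if "i \<in> I" for i
    using ms that unfolding m_def s_def by auto
  have "\<forall>w\<in>W. \<exists>pq. fst pq \<in> CSP E w \<and> snd pq \<in> CSP E w \<and> fst pq \<noteq> snd pq"
    using Wexp unfolding exposed_def branching_def by force
  from bchoice[OF this] obtain pq where pq:
    "\<forall>w\<in>W. fst (pq w) \<in> CSP E w \<and> snd (pq w) \<in> CSP E w \<and> fst (pq w) \<noteq> snd (pq w)" by blast
  \<comment> \<open>Distinct exponents \<open>N i\<close> make the paths \<open>c i\<close> parallel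
    whenever they have the same base.\<close>
  obtain N :: "_ \<Rightarrow> nat" where N: "inj_on N I"
    using finite_imp_inj_to_nat_seg[OF I] by blast
  define c where "c i = concat (replicate (N i) (fst (pq (m i)))) @ snd (pq (m i))" for i
  have c: "awalk (m i) (c i) (m i)" if "i \<in> I" for i
    unfolding c_def using awalk_append_trans[OF awalk_concat_replicate[OF CSP_awalk] CSP_awalk]
      pq m[OF that] by blast
  show thesis
  proof (rule that[of "\<lambda>i. ghost (m i) (s i) * ghost (m i) (c i) * x0 (m i)"
      "\<lambda>i. y0 (m i) * path (m i) (c i) * path (m i) (s i)"])
    fix i assume i: "i \<in> I"
    show "ghost (m i) (s i) * ghost (m i) (c i) * x0 (m i) \<in> L"
      using L_mult[OF L_mult[OF L_ghost[OF s] L_ghost[OF c]] x0(1)[OF m]] i by blast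
    show "y0 (m i) * path (m i) (c i) * path (m i) (s i) \<in> L"
      using L_mult[OF L_mult[OF x0(2)[OF m] L_path[OF c]] L_path[OF s]] i by blast
    fix j assume j: "j \<in> I"
    have eq: "ghost (m i) (s i) * ghost (m i) (c i) * x0 (m i) * a
        * (y0 (m j) * path (m j) (c j) * path (m j) (s j))
      = ghost (m i) (s i) * (ghost (m i) (c i) * (x0 (m i) * a * y0 (m j)) * path (m j) (c j))
        * path (m j) (s j)"
      by (simp add: mult.assoc)
    show "ghost (m i) (s i) * ghost (m i) (c i) * x0 (m i) * a
        * (y0 (m j) * path (m j) (c j) * path (m j) (s j)) = (if i = j then V (w i) else 0)"
    proof (cases "m i = m j")
      case False
      then show ?thesis unfolding eq using x0(3)[OF m[OF i] m[OF j]] by auto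
    next
      case True
      have *: "ghost (m i) (c i) * (x0 (m i) * a * y0 (m j)) = ghost (m i) (c i)"
        using x0(3)[OF m[OF i] m[OF j]] True ghost_V[OF c[OF i]] by simp
      show ?thesis
      proof (cases "i = j")
        case True
        then show ?thesis unfolding eq *
          using ghost_path[OF c[OF i]] ghost_V[OF s[OF i]] ghost_path[OF s[OF i]] by simp
      next
        case False
        have "N i \<noteq> N j" using N False i j by (auto simp: inj_on_def)
        then have "c i \<parallel> c j"
          unfolding c_def True
          by (rule CSP_power_parallel[where w = "m j", rotated 3]) (use pq m[OF j] in auto)
        then have "ghost (m i) (c i) * path (m j) (c j) = 0"
          using ghost_path_parallel[OF c[OF i]] c[OF j] True by simp
        then show ?thesis unfolding eq * using False by simp
      qed
    qed
  qed
qed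

text \<open>Orthogonality kills all cross terms of \<open>x' * a * y'\<close>, so the diagonal
  reproduces the summands of \<open>b\<close>. The vertices \<open>V (w z)\<close> are repeated in
  both factors to put these into \<open>lspan (P_ppi E)\<close>.\<close>

theorem exposed_ideal_factorization:
  assumes a: "a \<in> lspan (P_ppi E)" and b: "b \<in> exposed_ideal a"
  shows "\<exists>x\<in>lspan (P_ppi E). \<exists>y\<in>lspan (P_ppi E). b = x * a * y"
proof -
  have aL: "a \<in> L" using a lspan_subset_L[OF hereditary_P_ppi] by blast
  obtain t r where t: "finite t"
    "t \<subseteq> {c * V w * d | c w d. c \<in> L \<and> w \<in> exposed a \<and> d \<in> L}" "b = (\<Sum>z\<in>t. r z *s z)"
    using b unfolding exposed_ideal_def span_explicit by blast
  have "\<forall>z\<in>t. \<exists>g. z = fst g * V (fst (snd g)) * snd (snd g) \<and> fst g \<in> L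
      \<and> fst (snd g) \<in> exposed a \<and> snd (snd g) \<in> L"
    using t(2) by fastforce
  from bchoice[OF this] obtain g where g: "\<forall>z\<in>t. z = fst (g z) * V (fst (snd (g z))) * snd (snd (g z))
      \<and> fst (g z) \<in> L \<and> fst (snd (g z)) \<in> exposed a \<and> snd (snd (g z)) \<in> L"
    by blast
  define c where "c z = r z *s fst (g z)" for z
  define w where "w z = fst (snd (g z))" for z
  define d where "d z = snd (snd (g z))" for z
  have c: "c z \<in> L" and w: "w z \<in> exposed a" and d: "d z \<in> L" if "z \<in> t" for z
    using g that unfolding c_def w_def d_def by (auto intro: lspan_scale)
  have b_eq: "b = (\<Sum>z\<in>t. c z * V (w z) * d z)"
    unfolding t(3) c_def w_def d_def
    by (rule sum.cong) (use g in \<open>auto simp: scale_mult_left\<close>)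
  obtain x y where x: "\<And>z. z \<in> t \<Longrightarrow> x z \<in> L" and y: "\<And>z. z \<in> t \<Longrightarrow> y z \<in> L"
    and xy: "\<And>z z'. z \<in> t \<Longrightarrow> z' \<in> t \<Longrightarrow> x z * a * y z' = (if z = z' then V (w z) else 0)"
    by (rule orthogonal_copies[where w = w, OF aL t(1) w]) (assumption, rule that)
  have wv: "w z \<in> verts E" "V (w z) \<in> lspan (P_ppi E)" if "z \<in> t" for z
    using w[OF that] exposed_verts lspan_V unfolding exposed_def by blast+
  define x' where "x' = (\<Sum>z\<in>t. c z * V (w z) * x z)"
  define y' where "y' = (\<Sum>z\<in>t. y z * V (w z) * d z)"
  have "x' \<in> lspan (P_ppi E)" unfolding x'_def
    by (intro lspan_sum lspan_mult_right[OF hereditary_P_ppi] lspan_mult_left[OF hereditary_P_ppi] c wv x)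
  moreover have "y' \<in> lspan (P_ppi E)" unfolding y'_def
    by (intro lspan_sum lspan_mult_right[OF hereditary_P_ppi] lspan_mult_left[OF hereditary_P_ppi] d wv y)
  moreover have "x' * a * y' = b"
  proof -
    have term_eq: "(c z * V (w z) * x z) * a * (y z' * V (w z') * d z')
        = (if z = z' then c z * V (w z) * d z else 0)" if "z \<in> t" "z' \<in> t" for z z'
    proof -
      have "(c z * V (w z) * x z) * a * (y z' * V (w z') * d z')
          = c z * V (w z) * (x z * a * y z') * V (w z') * d z'"
        by (simp add: mult.assoc)
      also have "\<dots> = (if z = z' then c z * (V (w z) * V (w z) * V (w z)) * d z else 0)"
        using xy[OF that] by (simp add: mult.assoc)
      finally show ?thesis using wv that by (simp add: V_V)
    qed
    have "x' * a * y' = (\<Sum>z\<in>t. \<Sum>z'\<in>t. (c z * V (w z) * x z) * a * (y z' * V (w z') * d z'))"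
      unfolding x'_def y'_def by (simp add: sum_distrib_left sum_distrib_right) (rule sum.swap)
    also have "\<dots> = (\<Sum>z\<in>t. \<Sum>z'\<in>t. if z = z' then c z * V (w z) * d z else 0)"
      by (intro sum.cong refl term_eq)
    also have "\<dots> = b" unfolding b_eq using t(1) by simp
    finally show ?thesis .
  qed
  ultimately show ?thesis by blast
qed

text \<open>\<open>J\<close> is an ideal of \<open>lspan (P_ppi E)\<close> only, so neither closure
  under scalars nor under multiplication by \<open>L\<close> can be presupposed. Nevertheless, if it
  contained all exposed vertices, it would contain the exposed ideal and hence
  \<open>a\<close>.\<close>

theorem zero_divisors_outside:
  assumes a: "a \<in> lspan (P_ppi E)" "a \<notin> J" and J: "J \<subseteq> lspan (P_ppi E)" "0 \<in> J"
    and J_add: "\<And>x y. x \<in> J \<Longrightarrow> y \<in> J \<Longrightarrow> x + y \<in> J"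
    and J_mult: "\<And>x y. x \<in> J \<Longrightarrow> y \<in> lspan (P_ppi E) \<Longrightarrow> x * y \<in> J \<and> y * x \<in> J"
  shows "\<exists>s\<in>lspan (P_ppi E). \<exists>t\<in>lspan (P_ppi E). s \<notin> J \<and> t \<notin> J \<and> s * t = 0"
proof -
  have "\<exists>w\<in>exposed a. V w \<notin> J"
  proof (rule ccontr)
    assume "\<not> (\<exists>w\<in>exposed a. V w \<notin> J)"
    then have all: "V w \<in> J" if "w \<in> exposed a" for w using that by blast
    have "b \<in> J" if "b \<in> exposed_ideal a" for b
      using that unfolding exposed_ideal_def
    proof (induction rule: span_induct_alt)
      case base
      show ?case by (rule J(2))
    next
      case (step r z b)
      then obtain c w d where z: "z = c * V w * d" "c \<in> L" "w \<in> exposed a" "d \<in> L" by blast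
      have wv: "w \<in> verts E" "V w \<in> lspan (P_ppi E)"
        using z(3) exposed_verts lspan_V unfolding exposed_def by blast+
      \<comment> \<open>Idempotency of \<open>V w\<close> allows the scalar and both outer factors
        to be absorbed into elements of \<open>lspan (P_ppi E)\<close>.\<close>
      have "r *s z = ((r *s c) * V w) * V w * (V w * d)"
        using wv by (simp add: z scale_mult_left mult.assoc) (simp add: mult.assoc[symmetric] V_V)
      moreover have "(r *s c) * V w \<in> lspan (P_ppi E)" "V w * d \<in> lspan (P_ppi E)"
        using lspan_mult_left[OF hereditary_P_ppi lspan_scale[OF z(2)] wv(2)]
          lspan_mult_right[OF hereditary_P_ppi wv(2) z(4)] by blast+
      ultimately have "r *s z \<in> J" using J_mult all[OF z(3)] by simp
      then show ?case using J_add step.IH by blast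
    qed
    then show False using mem_exposed_ideal[OF a(1)] a(2) by blast
  qed
  then obtain w where w: "w \<in> exposed a" "V w \<notin> J" by blast
  then obtain p q where pq: "p \<in> CSP E w" "q \<in> CSP E w" "p \<noteq> q"
    unfolding exposed_def branching_def by blast
  have wH: "w \<in> P_ppi E" using w(1) unfolding exposed_def by blast
  note p = CSP_awalk[OF pq(1)] and q = CSP_awalk[OF pq(2)]
  have mem: "ghost w p \<in> lspan (P_ppi E)" "path w q \<in> lspan (P_ppi E)"
    "path w p \<in> lspan (P_ppi E)" "ghost w q \<in> lspan (P_ppi E)"
    using lspan_ghost[OF wH] lspan_path[OF wH] p q by blast+
  \<comment> \<open>Multiplying by \<open>path w p\<close> would bring \<open>V w\<close> into
    \<open>J\<close>.\<close>
  have "ghost w p \<notin> J" using J_mult[OF _ mem(3)] ghost_path[OF p] w(2) by metis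
  moreover have "path w q \<notin> J" using J_mult[OF _ mem(4)] ghost_path[OF q] w(2) by metis
  moreover have "ghost w p * path w q = 0"
    using ghost_path_parallel[OF p q CSP_parallel[OF pq]] .
  ultimately show ?thesis using mem by blast
qed

end

section \<open>Nonunital rings and their quotients\<close>

lemma nonunital_ringI:
  fixes R (structure)
  assumes "abelian_group R"
    and "\<And>x y. x \<in> carrier R \<Longrightarrow> y \<in> carrier R \<Longrightarrow> x \<otimes> y \<in> carrier R"
    and "\<And>x y z. x \<in> carrier R \<Longrightarrow> y \<in> carrier R \<Longrightarrow> z \<in> carrier R
      \<Longrightarrow> (x \<otimes> y) \<otimes> z = x \<otimes> (y \<otimes> z)"
    and "\<And>x y z. x \<in> carrier R \<Longrightarrow> y \<in> carrier R \<Longrightarrow> z \<in> carrier R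
      \<Longrightarrow> (x \<oplus> y) \<otimes> z = x \<otimes> z \<oplus> y \<otimes> z"
    and "\<And>x y z. x \<in> carrier R \<Longrightarrow> y \<in> carrier R \<Longrightarrow> z \<in> carrier R
      \<Longrightarrow> z \<otimes> (x \<oplus> y) = z \<otimes> x \<oplus> z \<otimes> y"
  shows "nonunital_ring R"
  by (intro nonunital_ring.intro nonunital_ring_axioms.intro assms)

context nonunital_ring
begin

lemma l_null: "x \<in> carrier R \<Longrightarrow> \<zero> \<otimes> x = \<zero>"
  using l_distr[of \<zero> \<zero> x] m_closed[of \<zero> x] by simp

lemma two_sided_idealI:
  assumes "I \<subseteq> carrier R" "\<zero> \<in> I"
    and add: "\<And>x y. x \<in> I \<Longrightarrow> y \<in> I \<Longrightarrow> x \<oplus> y \<in> I"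
    and minus: "\<And>x. x \<in> I \<Longrightarrow> \<ominus> x \<in> I"
    and mult: "\<And>a x. a \<in> I \<Longrightarrow> x \<in> carrier R \<Longrightarrow> x \<otimes> a \<in> I"
      "\<And>a x. a \<in> I \<Longrightarrow> x \<in> carrier R \<Longrightarrow> a \<otimes> x \<in> I"
  shows "two_sided_ideal I R"
proof -
  have "subgroup I (add_monoid R)"
    by (rule group.subgroupI[OF a_group]) (use assms in \<open>auto simp: a_inv_def\<close>)
  then show ?thesis
    by (intro two_sided_ideal.intro additive_subgroupI two_sided_ideal_axioms.intro
        nonunital_ring_axioms mult)
qed

lemma two_sided_ideal_carrier: "two_sided_ideal (carrier R) R"
  by (rule two_sided_idealI) (auto intro: m_closed)

lemma two_sided_ideal_Inter:
  assumes "\<I> \<noteq> {}" and "\<And>I. I \<in> \<I> \<Longrightarrow> two_sided_ideal I R"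
  shows "two_sided_ideal (\<Inter>\<I>) R"
proof -
  have sub: "additive_subgroup I R" if "I \<in> \<I>" for I
    using assms(2)[OF that] by (simp add: two_sided_ideal_def)
  show ?thesis
  proof (rule two_sided_idealI)
    show "\<Inter>\<I> \<subseteq> carrier R" using assms(1) additive_subgroup.a_subset[OF sub] by blast
    show "\<zero> \<in> \<Inter>\<I>" using additive_subgroup.zero_closed[OF sub] by simp
    show "x \<oplus> y \<in> \<Inter>\<I>" if "x \<in> \<Inter>\<I>" "y \<in> \<Inter>\<I>" for x y
      by (rule InterI, rule additive_subgroup.a_closed[OF sub]) (use that in auto)
    show "\<ominus> x \<in> \<Inter>\<I>" if "x \<in> \<Inter>\<I>" for x
      by (rule InterI, rule additive_subgroup.a_inv_closed[OF sub])
        (use that in auto)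
    show "x \<otimes> a \<in> \<Inter>\<I>" if "a \<in> \<Inter>\<I>" "x \<in> carrier R" for a x
      by (rule InterI, rule two_sided_ideal.ideal_l_closed[OF assms(2)]) (use that in auto)
    show "a \<otimes> x \<in> \<Inter>\<I>" if "a \<in> \<Inter>\<I>" "x \<in> carrier R" for a x
      by (rule InterI, rule two_sided_ideal.ideal_r_closed[OF assms(2)]) (use that in auto)
  qed
qed

lemma two_sided_ideal_gen_ideal:
  assumes "S \<subseteq> carrier R"
  shows "two_sided_ideal (two_sided_ideal_gen R S) R"
  unfolding two_sided_ideal_gen_def
  by (rule two_sided_ideal_Inter) (use assms two_sided_ideal_carrier in auto)

end

context two_sided_ideal
begin

sublocale abelian_subgroup I R
  by (rule abelian_subgroupI3) unfold_locales

lemma nonunital_ring_ideal: "nonunital_ring (R\<lparr>carrier := I\<rparr>)"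
proof -
  have sub: "x \<in> carrier R" if "x \<in> I" for x using that by (rule a_Hcarr)
  show ?thesis
  proof (intro nonunital_ringI abelian_groupI)
    fix x assume "x \<in> carrier (R\<lparr>carrier := I\<rparr>)"
    then show "\<exists>y\<in>carrier (R\<lparr>carrier := I\<rparr>). y \<oplus>\<^bsub>R\<lparr>carrier := I\<rparr>\<^esub> x = \<zero>\<^bsub>R\<lparr>carrier := I\<rparr>\<^esub>"
      using sub l_neg a_inv_closed by (intro bexI[of _ "\<ominus> x"]) auto
  qed (use sub in \<open>auto simp: a_ac m_assoc l_distr r_distr intro: ideal_l_closed\<close>)
qed

lemma rcosetsE:
  assumes "A \<in> carrier (R Quot I)"
  obtains x where "x \<in> carrier R" "A = I +> x"
  using assms by (auto simp: FactRing_def A_RCOSETS_def')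

lemma rcoset_in_quot: "x \<in> carrier R \<Longrightarrow> I +> x \<in> carrier (R Quot I)"
  by (auto simp: FactRing_def A_RCOSETS_def')

lemma quot_zero: "\<zero>\<^bsub>R Quot I\<^esub> = I"
  by (simp add: FactRing_def)

lemma rcoset_zero: "x \<in> I \<Longrightarrow> I +> x = I"
  by (rule a_rcos_const)

lemma rcoset_zero_iff:
  assumes "x \<in> carrier R"
  shows "I +> x = I \<longleftrightarrow> x \<in> I"
  using a_rcos_self[OF assms] rcoset_zero by blast

lemma quot_add: "x \<in> carrier R \<Longrightarrow> y \<in> carrier R \<Longrightarrow> (I +> x) \<oplus>\<^bsub>R Quot I\<^esub> (I +> y) = I +> (x \<oplus> y)"
  by (simp add: FactRing_def a_rcos_sum)

lemma rcosetE:
  assumes "a \<in> I +> x"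
  obtains h where "h \<in> I" "a = h \<oplus> x"
  using assms by (auto simp: a_r_coset_def')

lemma rcoset_eqI: "h \<in> I \<Longrightarrow> x \<in> carrier R \<Longrightarrow> I +> (h \<oplus> x) = I +> x"
  by (rule a_repr_independence'[symmetric]) (auto simp: a_r_coset_def')

text \<open>The product of cosets is a union over all representatives. Any two products of
  representatives differ by an element of \<open>I\<close>, so all cosets in the union
  coincide.\<close>

lemma quot_mult:
  assumes x: "x \<in> carrier R" and y: "y \<in> carrier R"
  shows "(I +> x) \<otimes>\<^bsub>R Quot I\<^esub> (I +> y) = I +> (x \<otimes> y)"
proof -
  have eq: "I +> (a \<otimes> b) = I +> (x \<otimes> y)" if ab: "a \<in> I +> x" "b \<in> I +> y" for a b
  proof -
    obtain h k where h: "h \<in> I" "a = h \<oplus> x" and k: "k \<in> I" "b = k \<oplus> y"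
      using ab rcosetE by metis
    have c: "h \<in> carrier R" "k \<in> carrier R" using h k a_Hcarr by auto
    have "a \<otimes> b = (h \<otimes> (k \<oplus> y) \<oplus> x \<otimes> k) \<oplus> x \<otimes> y"
      using c x y m_closed by (simp add: h k l_distr r_distr a_ac)
    moreover have "h \<otimes> (k \<oplus> y) \<oplus> x \<otimes> k \<in> I"
      using h k c x y ideal_l_closed ideal_r_closed by simp
    ultimately show ?thesis using rcoset_eqI x y m_closed by simp
  qed
  have "(I +> x) \<otimes>\<^bsub>R Quot I\<^esub> (I +> y) = (\<Union>a\<in>I +> x. \<Union>b\<in>I +> y. I +> (a \<otimes> b))"
    by (simp add: FactRing_def rcoset_mult_def)
  also have "\<dots> = I +> (x \<otimes> y)"
    using eq a_rcos_self[OF x] a_rcos_self[OF y] by blast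
  finally show ?thesis .
qed

lemma nonunital_ring_quot: "nonunital_ring (R Quot I)"
proof (intro nonunital_ringI abelian_groupI)
  fix A assume "A \<in> carrier (R Quot I)"
  then obtain x where x: "x \<in> carrier R" "A = I +> x" by (rule rcosetsE)
  then show "\<exists>B\<in>carrier (R Quot I). B \<oplus>\<^bsub>R Quot I\<^esub> A = \<zero>\<^bsub>R Quot I\<^esub>"
    using quot_add[of "\<ominus> x" x] rcoset_in_quot
    by (intro bexI[of _ "I +> (\<ominus> x)"]) (auto simp: quot_zero l_neg rcoset_zero)
next
  fix A assume "A \<in> carrier (R Quot I)"
  then obtain x where x: "x \<in> carrier R" "A = I +> x" by (rule rcosetsE)
  then show "\<zero>\<^bsub>R Quot I\<^esub> \<oplus>\<^bsub>R Quot I\<^esub> A = A"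
    using quot_add[of \<zero> x] by (simp add: quot_zero rcoset_zero)
next
  show "\<zero>\<^bsub>R Quot I\<^esub> \<in> carrier (R Quot I)"
    using rcoset_in_quot[OF zero_closed] by (simp add: quot_zero rcoset_zero)
qed (auto elim!: rcosetsE simp: quot_add quot_mult rcoset_in_quot a_ac m_assoc m_closed
      l_distr r_distr)

end

section \<open>Algebras over a field\<close>

locale scalar_algebra = nonunital_ring R for R :: "'a ring" (structure) +
  fixes sc :: "'k::field \<Rightarrow> 'a \<Rightarrow> 'a"
  assumes sc_closed: "x \<in> carrier R \<Longrightarrow> sc c x \<in> carrier R"
    and sc_add_right: "x \<in> carrier R \<Longrightarrow> y \<in> carrier R \<Longrightarrow> sc c (x \<oplus> y) = sc c x \<oplus> sc c y"
    and sc_add_left: "x \<in> carrier R \<Longrightarrow> sc (c + d) x = sc c x \<oplus> sc d x"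
    and sc_sc: "x \<in> carrier R \<Longrightarrow> sc c (sc d x) = sc (c * d) x"
    and sc_one: "x \<in> carrier R \<Longrightarrow> sc 1 x = x"
    and sc_mult_left: "x \<in> carrier R \<Longrightarrow> y \<in> carrier R \<Longrightarrow> sc c x \<otimes> y = sc c (x \<otimes> y)"
    and sc_mult_right: "x \<in> carrier R \<Longrightarrow> y \<in> carrier R \<Longrightarrow> x \<otimes> sc c y = sc c (x \<otimes> y)"
begin

lemma sc_zero: "sc c \<zero> = \<zero>"
  using sc_add_right[of \<zero> \<zero> c] sc_closed[of \<zero> c] by simp

end

text \<open>A union of cosets instead of the elementwise multiple of \<open>A\<close>, which for
  \<open>c = 0\<close> would consist of zero alone instead of all of \<open>I\<close>.\<close>

definition quot_scale ::
  "'a ring \<Rightarrow> 'a set \<Rightarrow> ('k \<Rightarrow> 'a \<Rightarrow> 'a) \<Rightarrow> 'k \<Rightarrow> 'a set \<Rightarrow> 'a set" where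
  "quot_scale R I sc c A = (\<Union>a\<in>A. I +>\<^bsub>R\<^esub> sc c a)"

context scalar_algebra
begin

context
  fixes I
  assumes I: "two_sided_ideal I R" and sc_I: "\<And>c x. x \<in> I \<Longrightarrow> sc c x \<in> I"
begin

lemma quot_scale_rcoset:
  assumes x: "x \<in> carrier R"
  shows "quot_scale R I sc c (I +> x) = I +> sc c x"
proof -
  interpret two_sided_ideal I R by (rule I)
  have "I +> sc c a = I +> sc c x" if "a \<in> I +> x" for a
  proof -
    obtain h where h: "h \<in> I" "a = h \<oplus> x" using \<open>a \<in> I +> x\<close> by (rule rcosetE)
    then show ?thesis
      using sc_add_right[of h x c] a_Hcarr x sc_I rcoset_eqI sc_closed by simp
  qed
  then show ?thesis unfolding quot_scale_def using a_rcos_self[OF x] by blast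
qed

lemma scalar_algebra_quot: "scalar_algebra (R Quot I) (quot_scale R I sc)"
proof -
  interpret two_sided_ideal I R by (rule I)
  show ?thesis
    by (intro scalar_algebra.intro scalar_algebra_axioms.intro nonunital_ring_quot)
      (auto elim!: rcosetsE simp: quot_scale_rcoset quot_add quot_mult rcoset_in_quot sc_closed
        m_closed sc_add_right sc_add_left sc_sc sc_one sc_mult_left sc_mult_right)
qed

end

end

subsection \<open>A type class ring containing all algebras with a given type of elements\<close>

text \<open>
  The direct product of all algebras on subsets of a fixed type is a single type, hence an instance
  of the class of rings, into which every such algebra embeds. This makes the simplifier and the
  sum library available for computations in an algebra that is given by a record.
\<close>

typedef (overloaded) ('k::field, 'a) algebra_product =
  "{F :: 'a ring \<times> ('k \<Rightarrow> 'a \<Rightarrow> 'a) \<Rightarrow> 'a.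
     \<forall>R sc. F (R, sc) \<in> (if scalar_algebra R sc then carrier R else {undefined})}"
proof -
  have "(\<lambda>(R, sc). if scalar_algebra R sc then \<zero>\<^bsub>R\<^esub> else undefined)
      (R, sc) \<in> (if scalar_algebra R sc then carrier R else {undefined})"
    for R :: "'a ring" and sc :: "'k \<Rightarrow> 'a \<Rightarrow> 'a"
    by (auto simp: scalar_algebra_def nonunital_ring_def intro: abelian_group.axioms abelian_monoid.zero_closed)
  then show ?thesis by blast
qed

definition component :: "'a ring \<Rightarrow> ('k::field \<Rightarrow> 'a \<Rightarrow> 'a) \<Rightarrow> ('k, 'a) algebra_product \<Rightarrow> 'a" where
  "component R sc a = Rep_algebra_product a (R, sc)"

definition family :: "('a ring \<Rightarrow> ('k::field \<Rightarrow> 'a \<Rightarrow> 'a) \<Rightarrow> 'a) \<Rightarrow> ('k, 'a) algebra_product" where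
  "family f = Abs_algebra_product (\<lambda>(R, sc). if scalar_algebra R sc then f R sc else undefined)"

lemma Rep_algebra_product_mem:
  "Rep_algebra_product a (R, sc) \<in> (if scalar_algebra R sc then carrier R else {undefined})"
  using Rep_algebra_product[of a] by blast

lemma component_closed: "scalar_algebra R sc \<Longrightarrow> component R sc a \<in> carrier R"
  using Rep_algebra_product_mem[of a R sc] unfolding component_def by simp

lemma component_family:
  assumes "\<And>R sc. scalar_algebra R sc \<Longrightarrow> f R sc \<in> carrier R" and "scalar_algebra R sc"
  shows "component R sc (family f) = f R sc"
  unfolding component_def family_def
  by (subst Abs_algebra_product_inverse) (use assms in auto)

text \<open>At an index that is not an algebra both elements take the value
  \<open>undefined\<close>, so the other components determine them.\<close>

lemma algebra_product_eqI:
  assumes "\<And>R sc. scalar_algebra R sc \<Longrightarrow> component R sc a = component R sc b"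
  shows "a = b"
proof -
  have "Rep_algebra_product a (R, sc) = Rep_algebra_product b (R, sc)" for R sc
  proof (cases "scalar_algebra R sc")
    case True
    then show ?thesis using assms unfolding component_def by blast
  next
    case False
    then show ?thesis
      using Rep_algebra_product_mem[of a R sc] Rep_algebra_product_mem[of b R sc] by simp
  qed
  then have "Rep_algebra_product a = Rep_algebra_product b" by (auto simp: fun_eq_iff)
  then show ?thesis by (simp add: Rep_algebra_product_inject)
qed

instantiation algebra_product :: (field, type) ring
begin

definition "0 = family (\<lambda>R sc. \<zero>\<^bsub>R\<^esub>)"
definition "a + b = family (\<lambda>R sc. component R sc a \<oplus>\<^bsub>R\<^esub> component R sc b)"
definition "- a = family (\<lambda>R sc. \<ominus>\<^bsub>R\<^esub> component R sc a)"
definition "a - b = family (\<lambda>R sc. component R sc a \<ominus>\<^bsub>R\<^esub> component R sc b)"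
definition "a * b = family (\<lambda>R sc. component R sc a \<otimes>\<^bsub>R\<^esub> component R sc b)"

lemma scalar_algebra_nonunital_ring: "scalar_algebra R sc \<Longrightarrow> nonunital_ring R"
  by (simp add: scalar_algebra_def)

lemma scalar_algebra_abelian: "scalar_algebra R sc \<Longrightarrow> abelian_group R"
  by (simp add: scalar_algebra_def nonunital_ring_def)

lemma component_zero: "scalar_algebra R sc \<Longrightarrow> component R sc 0 = \<zero>\<^bsub>R\<^esub>"
  unfolding zero_algebra_product_def
  by (rule component_family)
    (auto intro!: abelian_monoid.zero_closed abelian_group.axioms scalar_algebra_abelian)

lemma component_add:
  "scalar_algebra R sc \<Longrightarrow> component R sc (a + b) = component R sc a \<oplus>\<^bsub>R\<^esub> component R sc b"
  unfolding plus_algebra_product_def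
  by (rule component_family)
    (auto intro!: abelian_monoid.a_closed abelian_group.axioms scalar_algebra_abelian component_closed)

lemma component_minus: "scalar_algebra R sc \<Longrightarrow> component R sc (- a) = \<ominus>\<^bsub>R\<^esub> component R sc a"
  unfolding uminus_algebra_product_def
  by (rule component_family)
    (auto intro!: abelian_group.a_inv_closed scalar_algebra_abelian component_closed)

lemma component_diff:
  "scalar_algebra R sc \<Longrightarrow> component R sc (a - b) = component R sc a \<ominus>\<^bsub>R\<^esub> component R sc b"
  unfolding minus_algebra_product_def
  by (rule component_family)
    (auto intro!: abelian_group.minus_closed scalar_algebra_abelian component_closed)

lemma component_mult:
  "scalar_algebra R sc \<Longrightarrow> component R sc (a * b) = component R sc a \<otimes>\<^bsub>R\<^esub> component R sc b"
  unfolding times_algebra_product_def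
  by (rule component_family)
    (auto intro!: nonunital_ring.m_closed scalar_algebra_nonunital_ring component_closed)

lemmas component_simps = component_zero component_add component_minus component_diff component_mult

instance
proof
  fix a b c :: "('a, 'b) algebra_product"
  have *: "component R sc (a * b * c) = component R sc (a * (b * c))
      \<and> component R sc ((a + b) * c) = component R sc (a * c + b * c)
      \<and> component R sc (a * (b + c)) = component R sc (a * b + a * c)
      \<and> component R sc (a + b + c) = component R sc (a + (b + c))
      \<and> component R sc (a + b) = component R sc (b + a)
      \<and> component R sc (0 + a) = component R sc a
      \<and> component R sc (- a + a) = component R sc 0
      \<and> component R sc (a - b) = component R sc (a + - b)"
    if alg: "scalar_algebra R sc" for R :: "'b ring" and sc :: "'a \<Rightarrow> 'b \<Rightarrow> 'b"
  proof -
    interpret scalar_algebra R sc by (rule alg)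
    show ?thesis
      by (simp add: component_simps[OF alg] component_closed[OF alg] m_assoc l_distr r_distr
          a_ac r_neg a_minus_def)
  qed
  show "a * b * c = a * (b * c)" "(a + b) * c = a * c + b * c" "a * (b + c) = a * b + a * c"
    "a + b + c = a + (b + c)" "a + b = b + a" "0 + a = a" "- a + a = 0" "a - b = a + - b"
    by (rule algebra_product_eqI, drule *, elim conjE, assumption)+
qed

end

definition product_scale :: "'k::field \<Rightarrow> ('k, 'a) algebra_product \<Rightarrow> ('k, 'a) algebra_product" where
  "product_scale c a = family (\<lambda>R sc. sc c (component R sc a))"

lemma component_scale:
  fixes R :: "'b ring" and sc :: "'a::field \<Rightarrow> 'b \<Rightarrow> 'b"
  shows "scalar_algebra R sc \<Longrightarrow> component R sc (product_scale c a) = sc c (component R sc a)"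
  unfolding product_scale_def
proof (rule component_family)
  fix R :: "'b ring" and sc :: "'a \<Rightarrow> 'b \<Rightarrow> 'b"
  assume alg: "scalar_algebra R sc"
  show "sc c (component R sc a) \<in> carrier R"
    by (rule scalar_algebra.sc_closed[OF alg component_closed[OF alg]])
qed

lemma product_scale_laws:
  "product_scale c (a + b) = product_scale c a + product_scale c b"
  "product_scale (c + d) a = product_scale c a + product_scale d a"
  "product_scale c (product_scale d a) = product_scale (c * d) a"
  "product_scale 1 a = a"
  "product_scale c a * b = product_scale c (a * b)"
  "a * product_scale c b = product_scale c (a * b)"
proof -
  have *: "component R sc (product_scale c (a + b)) = component R sc (product_scale c a + product_scale c b)
    \<and> component R sc (product_scale (c + d) a) = component R sc (product_scale c a + product_scale d a)
    \<and> component R sc (product_scale c (product_scale d a)) = component R sc (product_scale (c * d) a)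
    \<and> component R sc (product_scale 1 a) = component R sc a
    \<and> component R sc (product_scale c a * b) = component R sc (product_scale c (a * b))
    \<and> component R sc (a * product_scale c b) = component R sc (product_scale c (a * b))"
    if alg: "scalar_algebra R sc" for R sc
  proof -
    interpret scalar_algebra R sc by (rule alg)
    show ?thesis
      by (simp add: component_simps[OF alg] component_scale[OF alg] component_closed[OF alg]
          sc_add_right sc_add_left sc_sc sc_one sc_mult_left sc_mult_right)
  qed
  show "product_scale c (a + b) = product_scale c a + product_scale c b"
    "product_scale (c + d) a = product_scale c a + product_scale d a"
    "product_scale c (product_scale d a) = product_scale (c * d) a"
    "product_scale 1 a = a"
    "product_scale c a * b = product_scale c (a * b)"
    "a * product_scale c b = product_scale c (a * b)"
    by (rule algebra_product_eqI, drule *, elim conjE, assumption)+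
qed

text \<open>Extension by zero in all other factors is compatible with products, as no unit has to be
  preserved.\<close>

definition embed :: "'a ring \<Rightarrow> ('k::field \<Rightarrow> 'a \<Rightarrow> 'a) \<Rightarrow> 'a \<Rightarrow> ('k, 'a) algebra_product" where
  "embed R sc x = family (\<lambda>R' sc'. if R' = R \<and> sc' = sc then x else \<zero>\<^bsub>R'\<^esub>)"

context scalar_algebra
begin

lemma component_embed_general:
  assumes "x \<in> carrier R" and alg: "scalar_algebra R' sc'"
  shows "component R' sc' (embed R sc x) = (if R' = R \<and> sc' = sc then x else \<zero>\<^bsub>R'\<^esub>)"
  unfolding embed_def
  by (rule component_family[OF _ alg])
    (use assms in \<open>auto intro!: abelian_monoid.zero_closed abelian_group.axioms scalar_algebra_abelian\<close>)

lemma component_embed: "x \<in> carrier R \<Longrightarrow> component R sc (embed R sc x) = x"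
  using component_embed_general[OF _ scalar_algebra_axioms] by simp

lemma embed_hom:
  "x \<in> carrier R \<Longrightarrow> y \<in> carrier R \<Longrightarrow> embed R sc (x \<oplus> y) = embed R sc x + embed R sc y"
  "x \<in> carrier R \<Longrightarrow> y \<in> carrier R \<Longrightarrow> embed R sc (x \<otimes> y) = embed R sc x * embed R sc y"
  "x \<in> carrier R \<Longrightarrow> embed R sc (sc c x) = product_scale c (embed R sc x)"
  "embed R sc \<zero> = 0"
proof -
  have *: "component R' sc' (embed R sc (x \<oplus> y)) = component R' sc' (embed R sc x + embed R sc y)
    \<and> component R' sc' (embed R sc (x \<otimes> y)) = component R' sc' (embed R sc x * embed R sc y)
    \<and> component R' sc' (embed R sc (sc c x)) = component R' sc' (product_scale c (embed R sc x))
    \<and> component R' sc' (embed R sc \<zero>) = component R' sc' 0"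
    if alg: "scalar_algebra R' sc'" and x: "x \<in> carrier R" and y: "y \<in> carrier R" for R' sc' x y
  proof -
    interpret R': scalar_algebra R' sc' by (rule alg)
    show ?thesis
      using x y by (auto simp: component_simps[OF alg] component_scale[OF alg]
          component_embed_general[OF _ alg] m_closed sc_closed R'.l_null R'.sc_zero)
  qed
  show "embed R sc (x \<oplus> y) = embed R sc x + embed R sc y"
    "embed R sc (x \<otimes> y) = embed R sc x * embed R sc y"
    if "x \<in> carrier R" "y \<in> carrier R"
    by (rule algebra_product_eqI, drule *[OF _ that], elim conjE, assumption)+
  show "embed R sc (sc c x) = product_scale c (embed R sc x)" if "x \<in> carrier R"
    by (rule algebra_product_eqI, drule *[OF _ that that], elim conjE, assumption)
  show "embed R sc \<zero> = 0"
    by (rule algebra_product_eqI, drule *[OF _ zero_closed zero_closed], elim conjE, assumption)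
qed

end

lemma (in scalar_algebra) embed_minus:
  assumes "x \<in> carrier R"
  shows "embed R sc (\<ominus> x) = - embed R sc x"
proof -
  have "embed R sc (\<ominus> x) + embed R sc x = embed R sc (\<ominus> x \<oplus> x)"
    using assms by (simp add: embed_hom)
  also have "\<dots> = 0" using assms by (simp add: l_neg embed_hom)
  finally show ?thesis by (simp add: eq_neg_iff_add_eq_0)
qed

section \<open>The free algebra\<close>

definition convolution :: "('b list \<Rightarrow> 'k::field) \<Rightarrow> ('b list \<Rightarrow> 'k) \<Rightarrow> 'b list \<Rightarrow> 'k" where
  "convolution f g w = (\<Sum>i\<le>length w. f (take i w) * g (drop i w))"

lemma convolution_Nil: "convolution f g [] = f [] * g []"
  by (simp add: convolution_def)

text \<open>The splitting with empty left part is set apart. This recursion on the word spares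
  \<open>convolution_assoc\<close> the reindexing of a double sum.\<close>

lemma convolution_Cons:
  "convolution f g (x # w) = f [] * g (x # w) + convolution (\<lambda>u. f (x # u)) g w"
  by (simp add: convolution_def sum.atMost_Suc_shift del: sum.atMost_Suc)

lemma convolution_add_left:
  "convolution (\<lambda>w. f w + g w) h w = convolution f h w + convolution g h w"
  by (simp add: convolution_def distrib_right sum.distrib)

lemma convolution_add_right:
  "convolution h (\<lambda>w. f w + g w) w = convolution h f w + convolution h g w"
  by (simp add: convolution_def distrib_left sum.distrib)

lemma convolution_scale_left: "convolution (\<lambda>w. c * f w) g w = c * convolution f g w"
  by (simp add: convolution_def sum_distrib_left mult.assoc)

lemma convolution_scale_right: "convolution f (\<lambda>w. c * g w) w = c * convolution f g w"
  by (simp add: convolution_def sum_distrib_left mult.left_commute)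

text \<open>The functions are arbitrary and generalized in the induction, so that the hypothesis
  covers the shifted function that \<open>convolution_Cons\<close> produces.\<close>

lemma convolution_assoc:
  "convolution (\<lambda>u. convolution f g u) h w = convolution f (\<lambda>u. convolution g h u) w"
proof (induction w arbitrary: f g)
  case Nil
  show ?case by (simp add: convolution_Nil)
next
  case (Cons x w)
  show ?case
    by (simp add: convolution_Cons convolution_Nil convolution_add_left convolution_scale_left
        Cons.IH distrib_left add.assoc mult.assoc)
qed

lemma convolution_nonzero:
  assumes "convolution f g w \<noteq> 0"
  obtains u v where "w = u @ v" "f u \<noteq> 0" "g v \<noteq> 0"
proof -
  obtain i where "f (take i w) * g (drop i w) \<noteq> 0"
    using assms unfolding convolution_def by (rule sum.not_neutral_contains_not_neutral)
  then show thesis using that[of "take i w" "drop i w"] by simp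
qed

lemma lpa_words_append: "u \<in> lpa_words E \<Longrightarrow> v \<in> lpa_words E \<Longrightarrow> u @ v \<in> lpa_words E"
  unfolding lpa_words_def by auto

definition free_scale :: "'k::field \<Rightarrow> ('v, 'e, 'k) free_elt \<Rightarrow> ('v, 'e, 'k) free_elt" where
  "free_scale c f = (\<lambda>w. c * f w)"

lemma free_algebra_simps:
  "f \<oplus>\<^bsub>free_algebra K E\<^esub> g = (\<lambda>w. f w + g w)"
  "f \<otimes>\<^bsub>free_algebra K E\<^esub> g = convolution f g"
  "\<zero>\<^bsub>free_algebra K E\<^esub> = (\<lambda>_. 0)"
  by (auto simp: free_algebra_def convolution_def fun_eq_iff)

lemma free_algebra_carrier_iff:
  "f \<in> carrier (free_algebra K E) \<longleftrightarrow> finite {w. f w \<noteq> 0} \<and> {w. f w \<noteq> 0} \<subseteq> lpa_words E"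
  by (simp add: free_algebra_def)

lemma free_algebra_carrier_subsetI:
  assumes "f \<in> carrier (free_algebra K E)" "g \<in> carrier (free_algebra K E)"
    and "\<And>w. h w \<noteq> 0 \<Longrightarrow> f w \<noteq> 0 \<or> g w \<noteq> 0"
  shows "h \<in> carrier (free_algebra K E)"
proof -
  have "{w. h w \<noteq> 0} \<subseteq> {w. f w \<noteq> 0} \<union> {w. g w \<noteq> 0}" using assms(3) by blast
  then show ?thesis
    using assms(1,2) finite_subset unfolding free_algebra_carrier_iff by blast
qed

lemma free_algebra_closed:
  assumes f: "f \<in> carrier (free_algebra K E)" and g: "g \<in> carrier (free_algebra K E)"
  shows "(\<lambda>w. f w + g w) \<in> carrier (free_algebra K E)"
    and "(\<lambda>w. f w - g w) \<in> carrier (free_algebra K E)"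
    and "(\<lambda>w. c * f w) \<in> carrier (free_algebra K E)"
    and "convolution f g \<in> carrier (free_algebra K E)"
proof -
  show "(\<lambda>w. f w + g w) \<in> carrier (free_algebra K E)"
    by (rule free_algebra_carrier_subsetI[OF f g]) auto
  show "(\<lambda>w. f w - g w) \<in> carrier (free_algebra K E)"
    by (rule free_algebra_carrier_subsetI[OF f g]) auto
  show "(\<lambda>w. c * f w) \<in> carrier (free_algebra K E)"
    by (rule free_algebra_carrier_subsetI[OF f f]) auto
  have "{w. convolution f g w \<noteq> 0} \<subseteq> (\<lambda>(u, v). u @ v) ` ({w. f w \<noteq> 0} \<times> {w. g w \<noteq> 0})"
    by (auto elim!: convolution_nonzero)
  moreover have "finite ((\<lambda>(u, v). u @ v) ` ({w. f w \<noteq> 0} \<times> {w. g w \<noteq> 0}))"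
    using f g unfolding free_algebra_carrier_iff by blast
  moreover have "(\<lambda>(u, v). u @ v) ` ({w. f w \<noteq> 0} \<times> {w. g w \<noteq> 0}) \<subseteq> lpa_words E"
    using f g unfolding free_algebra_carrier_iff by (auto intro!: lpa_words_append)
  ultimately show "convolution f g \<in> carrier (free_algebra K E)"
    unfolding free_algebra_carrier_iff using finite_subset by blast
qed

lemma free_algebra_zero_closed: "(\<lambda>_. 0) \<in> carrier (free_algebra K E)"
  by (simp add: free_algebra_carrier_iff)

lemma scalar_algebra_free: "scalar_algebra (free_algebra K E) free_scale"
proof (intro scalar_algebra.intro scalar_algebra_axioms.intro nonunital_ringI abelian_groupI)
  fix f assume f: "f \<in> carrier (free_algebra K E)"
  show "\<exists>g\<in>carrier (free_algebra K E).
      g \<oplus>\<^bsub>free_algebra K E\<^esub> f = \<zero>\<^bsub>free_algebra K E\<^esub>"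
    using free_algebra_closed(2)[OF free_algebra_zero_closed f]
    by (intro bexI[of _ "\<lambda>w. 0 - f w"]) (auto simp: free_algebra_simps)
qed (auto simp: free_algebra_simps free_algebra_closed free_algebra_zero_closed free_scale_def
      convolution_assoc convolution_add_left convolution_add_right convolution_scale_left
      convolution_scale_right fun_eq_iff algebra_simps)

lemma monomial_closed: "w \<in> lpa_words E \<Longrightarrow> monomial w \<in> carrier (free_algebra K E)"
  by (auto simp: free_algebra_carrier_iff monomial_def)

lemma convolution_monomial:
  "convolution (monomial u) (monomial v) = (monomial (u @ v) :: ('v, 'e, 'k::field) free_elt)"
proof
  fix w :: "('v, 'e) lpa_gen list"
  have "convolution (monomial u) (monomial v) w
      = (\<Sum>i\<le>length w. if i = length u \<and> w = u @ v then 1 else (0 :: 'k))"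
    unfolding convolution_def monomial_def
  proof (rule sum.cong[OF refl])
    fix i assume "i \<in> {..length w}"
    then have "take i w = u \<and> drop i w = v \<longleftrightarrow> i = length u \<and> w = u @ v"
      by (metis append_eq_conv_conj append_take_drop_id atMost_iff length_take min.absorb2)
    then show "(if take i w = u then 1 else 0) * (if drop i w = v then 1 else 0)
        = (if i = length u \<and> w = u @ v then 1 else (0 :: 'k))"
      by auto
  qed
  also have "\<dots> = monomial (u @ v) w"
    by (cases "w = u @ v") (auto simp: monomial_def)
  finally show "convolution (monomial u) (monomial v) w = (monomial (u @ v) w :: 'k)" .
qed

section \<open>The Leavitt path algebra as an algebra with a Leavitt family\<close>

locale leavitt_algebra = wf_digraph E for E :: "('v, 'e) pre_digraph" +
  fixes K :: "'k::field itself"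
begin

abbreviation F :: "('v, 'e, 'k) free_elt ring" where "F \<equiv> free_algebra K E"
abbreviation J :: "('v, 'e, 'k) free_elt set" where "J \<equiv> lpa_rel_ideal K E"
abbreviation R :: "('v, 'e, 'k) free_elt set ring" where "R \<equiv> leavitt_path_algebra K E"
abbreviation qscale :: "'k \<Rightarrow> ('v, 'e, 'k) free_elt set \<Rightarrow> ('v, 'e, 'k) free_elt set" where
  "qscale \<equiv> quot_scale F J free_scale"

lemma R_eq: "R = F Quot J"
  by (simp add: leavitt_path_algebra_def)

lemma words:
  "v \<in> verts E \<Longrightarrow> [Vtx v] \<in> lpa_words E"
  "v \<in> verts E \<Longrightarrow> w \<in> verts E \<Longrightarrow> [Vtx v, Vtx w] \<in> lpa_words E"
  "e \<in> arcs E \<Longrightarrow> [Edge e] \<in> lpa_words E"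
  "e \<in> arcs E \<Longrightarrow> [Ghost e] \<in> lpa_words E"
  "e \<in> arcs E \<Longrightarrow> [Vtx (tail E e), Edge e] \<in> lpa_words E"
  "e \<in> arcs E \<Longrightarrow> [Edge e, Vtx (head E e)] \<in> lpa_words E"
  "e \<in> arcs E \<Longrightarrow> [Vtx (head E e), Ghost e] \<in> lpa_words E"
  "e \<in> arcs E \<Longrightarrow> [Ghost e, Vtx (tail E e)] \<in> lpa_words E"
  "e \<in> arcs E \<Longrightarrow> f \<in> arcs E \<Longrightarrow> [Ghost e, Edge f] \<in> lpa_words E"
  "e \<in> arcs E \<Longrightarrow> f \<in> arcs E \<Longrightarrow> [Edge e, Ghost f] \<in> lpa_words E"
  unfolding lpa_words_def by auto

lemma sum_closed:
  "finite A \<Longrightarrow> (\<And>i. i \<in> A \<Longrightarrow> f i \<in> carrier F) \<Longrightarrow> (\<lambda>u. \<Sum>i\<in>A. f i u) \<in> carrier F"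
proof (induction A rule: finite_induct)
  case empty
  show ?case by (simp add: free_algebra_zero_closed)
next
  case (insert i A)
  then show ?case using free_algebra_closed(1)[of "f i" K E "\<lambda>u. \<Sum>i\<in>A. f i u"] by simp
qed

lemma relators_closed: "lpa_relators K E \<subseteq> carrier F"
proof -
  have diff: "f - g \<in> carrier F" if "f \<in> carrier F" "g \<in> carrier F" for f g
    using free_algebra_closed(2)[OF that] by (simp add: fun_diff_def)
  have CK: "(\<lambda>u. \<Sum>e\<in>out_arcs E v. monomial [Edge e, Ghost e] u) \<in> carrier F"
    if "regular_vertex E v" for v
    by (rule sum_closed) (use that in \<open>auto simp: regular_vertex_def intro!: monomial_closed words\<close>)
  have "regular_vertex E v \<Longrightarrow> v \<in> verts E" for v by (simp add: regular_vertex_def)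
  then show ?thesis
    unfolding lpa_relators_def
    by (auto intro!: diff monomial_closed words CK free_algebra_zero_closed)
qed

lemma ideal_J: "two_sided_ideal J F"
  and scale_J: "\<And>c f. f \<in> J \<Longrightarrow> free_scale c f \<in> J"
  and relators_J: "lpa_relators K E \<subseteq> J"
proof -
  interpret F: scalar_algebra F free_scale by (rule scalar_algebra_free)
  let ?\<J> = "{J. two_sided_ideal J F \<and> (\<forall>c. \<forall>f\<in>J. (\<lambda>w. c * f w) \<in> J) \<and> lpa_relators K E \<subseteq> J}"
  have "carrier F \<in> ?\<J>"
    using F.two_sided_ideal_carrier free_algebra_closed(3) relators_closed by blast
  then have "?\<J> \<noteq> {}" by blast
  then show "two_sided_ideal J F"
    unfolding lpa_rel_ideal_def by (rule F.two_sided_ideal_Inter) simp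
  show "free_scale c f \<in> J" if "f \<in> J" for c f
    using that unfolding lpa_rel_ideal_def free_scale_def by blast
  show "lpa_relators K E \<subseteq> J" unfolding lpa_rel_ideal_def by blast
qed

sublocale R: scalar_algebra R qscale
  unfolding R_eq
  by (rule scalar_algebra.scalar_algebra_quot[OF scalar_algebra_free ideal_J]) (rule scale_J)

section \<open>The Leavitt relations in the product ring\<close>

definition cls :: "('v, 'e, 'k) free_elt \<Rightarrow> ('k, ('v, 'e, 'k) free_elt set) algebra_product" where
  "cls f = embed R qscale (J +>\<^bsub>F\<^esub> f)"

lemma rcoset_closed: "f \<in> carrier F \<Longrightarrow> J +>\<^bsub>F\<^esub> f \<in> carrier R"
  unfolding R_eq by (rule two_sided_ideal.rcoset_in_quot[OF ideal_J])

lemma cls_add: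
  assumes "f \<in> carrier F" "g \<in> carrier F"
  shows "cls (\<lambda>w. f w + g w) = cls f + cls g"
proof -
  have "J +>\<^bsub>F\<^esub> (\<lambda>w. f w + g w) = (J +>\<^bsub>F\<^esub> f) \<oplus>\<^bsub>R\<^esub> (J +>\<^bsub>F\<^esub> g)"
    using two_sided_ideal.quot_add[OF ideal_J assms] by (simp add: R_eq free_algebra_simps)
  then show ?thesis unfolding cls_def using R.embed_hom(1) rcoset_closed assms by simp
qed

lemma cls_mult:
  assumes "f \<in> carrier F" "g \<in> carrier F"
  shows "cls (convolution f g) = cls f * cls g"
proof -
  have "J +>\<^bsub>F\<^esub> convolution f g = (J +>\<^bsub>F\<^esub> f) \<otimes>\<^bsub>R\<^esub> (J +>\<^bsub>F\<^esub> g)"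
    using two_sided_ideal.quot_mult[OF ideal_J assms] by (simp add: R_eq free_algebra_simps)
  then show ?thesis unfolding cls_def using R.embed_hom(2) rcoset_closed assms by simp
qed

lemma cls_scale:
  assumes "f \<in> carrier F"
  shows "cls (\<lambda>w. c * f w) = product_scale c (cls f)"
proof -
  have "J +>\<^bsub>F\<^esub> (\<lambda>w. c * f w) = qscale c (J +>\<^bsub>F\<^esub> f)"
    using scalar_algebra.quot_scale_rcoset[OF scalar_algebra_free ideal_J scale_J assms, of c]
    unfolding free_scale_def[of c f] by simp
  then show ?thesis unfolding cls_def using R.embed_hom(3) rcoset_closed assms by simp
qed

lemma cls_eqI:
  assumes "f - g \<in> J" "g \<in> carrier F"
  shows "cls f = cls g"
proof -
  have "(f - g) \<oplus>\<^bsub>F\<^esub> g = f" by (simp add: free_algebra_simps fun_eq_iff)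
  then show ?thesis
    unfolding cls_def using two_sided_ideal.rcoset_eqI[OF ideal_J assms] by simp
qed

lemma cls_zero: "cls (\<lambda>_. 0) = 0"
  using cls_scale[of "\<lambda>_. 0" 0] cls_add[of "\<lambda>_. 0" "\<lambda>_. 0"] free_algebra_zero_closed[of K E]
  by simp

lemma cls_sum:
  "finite A \<Longrightarrow> (\<And>i. i \<in> A \<Longrightarrow> f i \<in> carrier F) \<Longrightarrow> cls (\<lambda>u. \<Sum>i\<in>A. f i u) = (\<Sum>i\<in>A. cls (f i))"
proof (induction A rule: finite_induct)
  case empty
  show ?case by (simp add: cls_zero)
next
  case (insert i A)
  then show ?case using cls_add[of "f i" "\<lambda>u. \<Sum>i\<in>A. f i u"] sum_closed[of A f] by simp
qed

lemma cls_monomial_Cons: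
  assumes "[x] \<in> lpa_words E" "w \<in> lpa_words E"
  shows "cls (monomial (x # w)) = cls (monomial [x]) * cls (monomial w)"
  using cls_mult[OF monomial_closed[OF assms(1)] monomial_closed[OF assms(2)]]
  by (simp add: convolution_monomial)

sublocale leavitt_family E product_scale
  "\<lambda>v. cls (monomial [Vtx v])" "\<lambda>e. cls (monomial [Edge e])" "\<lambda>e. cls (monomial [Ghost e])"
proof (unfold_locales)
  have rel: "cls f = cls g" if "f - g \<in> lpa_relators K E" "g \<in> carrier F" for f g
    using cls_eqI that relators_J by blast
  note mon = monomial_closed[OF words(1)] monomial_closed[OF words(3)] monomial_closed[OF words(4)]
  fix v w e f c and a b :: "('k, ('v, 'e, 'k) free_elt set) algebra_product"
  show "product_scale c a * b = product_scale c (a * b)" by (rule product_scale_laws)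
  show "a * product_scale c b = product_scale c (a * b)" by (rule product_scale_laws)
  show "cls (monomial [Vtx v]) * cls (monomial [Vtx w]) = (if v = w then cls (monomial [Vtx v]) else 0)"
    if "v \<in> verts E" "w \<in> verts E"
  proof -
    have "cls (monomial [Vtx v, Vtx w]) = cls (if v = w then monomial [Vtx v] else (\<lambda>_. 0))"
      by (rule rel) (use that in \<open>auto simp: lpa_relators_def mon free_algebra_zero_closed\<close>)
    then show ?thesis using cls_monomial_Cons words that by (simp add: cls_zero)
  qed
  show "cls (monomial [Vtx (tail E e)]) * cls (monomial [Edge e]) = cls (monomial [Edge e])"
    if "e \<in> arcs E"
  proof -
    have "cls (monomial [Vtx (tail E e), Edge e]) = cls (monomial [Edge e])"
      by (rule rel) (use that in \<open>auto simp: lpa_relators_def mon\<close>)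
    then show ?thesis using cls_monomial_Cons words that by simp
  qed
  show "cls (monomial [Edge e]) * cls (monomial [Vtx (head E e)]) = cls (monomial [Edge e])"
    if "e \<in> arcs E"
  proof -
    have "cls (monomial [Edge e, Vtx (head E e)]) = cls (monomial [Edge e])"
      by (rule rel) (use that in \<open>auto simp: lpa_relators_def mon\<close>)
    then show ?thesis using cls_monomial_Cons words that by simp
  qed
  show "cls (monomial [Vtx (head E e)]) * cls (monomial [Ghost e]) = cls (monomial [Ghost e])"
    if "e \<in> arcs E"
  proof -
    have "cls (monomial [Vtx (head E e), Ghost e]) = cls (monomial [Ghost e])"
      by (rule rel) (use that in \<open>auto simp: lpa_relators_def mon\<close>)
    then show ?thesis using cls_monomial_Cons words that by simp
  qed
  show "cls (monomial [Ghost e]) * cls (monomial [Vtx (tail E e)]) = cls (monomial [Ghost e])"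
    if "e \<in> arcs E"
  proof -
    have "cls (monomial [Ghost e, Vtx (tail E e)]) = cls (monomial [Ghost e])"
      by (rule rel) (use that in \<open>auto simp: lpa_relators_def mon\<close>)
    then show ?thesis using cls_monomial_Cons words that by simp
  qed
  show "cls (monomial [Ghost e]) * cls (monomial [Edge f])
      = (if e = f then cls (monomial [Vtx (head E e)]) else 0)"
    if "e \<in> arcs E" "f \<in> arcs E"
  proof -
    have "cls (monomial [Ghost e, Edge f])
        = cls (if e = f then monomial [Vtx (head E e)] else (\<lambda>_. 0))"
      by (rule rel) (use that in \<open>auto simp: lpa_relators_def mon free_algebra_zero_closed\<close>)
    then show ?thesis using cls_monomial_Cons words that by (simp add: cls_zero)
  qed
  show "cls (monomial [Vtx v]) = (\<Sum>e\<in>out_arcs E v. cls (monomial [Edge e]) * cls (monomial [Ghost e]))"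
    if v: "regular_vertex E v"
  proof -
    have fin: "finite (out_arcs E v)" using v by (simp add: regular_vertex_def)
    have mono: "monomial [Edge e, Ghost e] \<in> carrier F" if "e \<in> out_arcs E v" for e
      using that by (intro monomial_closed words) auto
    have "cls (monomial [Vtx v]) = cls (\<lambda>u. \<Sum>e\<in>out_arcs E v. monomial [Edge e, Ghost e] u)"
    proof (rule rel)
      show "monomial [Vtx v] - (\<lambda>u. \<Sum>e\<in>out_arcs E v. monomial [Edge e, Ghost e] u)
          \<in> lpa_relators K E"
        unfolding lpa_relators_def by (intro UnI2 CollectI exI[of _ v] conjI refl v)
    qed (rule sum_closed[OF fin mono])
    also have "\<dots> = (\<Sum>e\<in>out_arcs E v. cls (monomial [Edge e, Ghost e]))"
      by (rule cls_sum[OF fin mono])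
    also have "\<dots> = (\<Sum>e\<in>out_arcs E v. cls (monomial [Edge e]) * cls (monomial [Ghost e]))"
      by (rule sum.cong) (auto simp: cls_monomial_Cons words)
    finally show ?thesis .
  qed
qed (simp_all add: product_scale_laws)

section \<open>The image of the Leavitt path algebra lies in the span of monomials\<close>

lemma cls_monomial_L: "w \<in> lpa_words E \<Longrightarrow> cls (monomial w) \<in> L"
proof (induction w)
  case Nil
  then show ?case by (simp add: lpa_words_def)
next
  case (Cons x w)
  have x: "[x] \<in> lpa_words E" using Cons.prems by (auto simp: lpa_words_def)
  then have xL: "cls (monomial [x]) \<in> L"
    using L_V L_X L_X' by (auto simp: lpa_words_def)
  show ?case
  proof (cases "w = []")
    case False
    then have "w \<in> lpa_words E" using Cons.prems by (auto simp: lpa_words_def)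
    then show ?thesis using Cons.IH L_mult[OF xL] cls_monomial_Cons[OF x] by simp
  qed (use xL in simp)
qed

text \<open>An element of the free algebra is a finite combination of words, and words are products
  of generators, which lie in \<open>L\<close>.\<close>

lemma cls_L:
  assumes "f \<in> carrier F"
  shows "cls f \<in> L"
proof -
  define A where "A = {w. f w \<noteq> 0}"
  have A: "finite A" "A \<subseteq> lpa_words E" using assms unfolding A_def free_algebra_carrier_iff by auto
  have c: "(\<lambda>u. f w * monomial w u) \<in> carrier F" if "w \<in> A" for w
    using free_algebra_closed(3)[OF monomial_closed monomial_closed] A that by blast
  have "f u = (\<Sum>w\<in>A. f w * monomial w u)" for u
  proof -
    have "(\<Sum>w\<in>A. f w * monomial w u) = (\<Sum>w\<in>A. if u = w then f w else 0)"
      by (rule sum.cong) (auto simp: monomial_def)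
    also have "\<dots> = f u" using A(1) by (auto simp: A_def)
    finally show ?thesis ..
  qed
  then have "f = (\<lambda>u. \<Sum>w\<in>A. f w * monomial w u)" by blast
  then have "cls f = cls (\<lambda>u. \<Sum>w\<in>A. f w * monomial w u)" by (rule arg_cong)
  also have "\<dots> = (\<Sum>w\<in>A. cls (\<lambda>u. f w * monomial w u))"
    by (rule cls_sum[where f = "\<lambda>w u. f w * monomial w u", OF A(1)]) (rule c)
  also have "\<dots> = (\<Sum>w\<in>A. product_scale (f w) (cls (monomial w)))"
    by (rule sum.cong) (use A(2) in \<open>auto intro!: cls_scale monomial_closed\<close>)
  also have "\<dots> \<in> L" by (rule lspan_sum) (use A(2) cls_monomial_L lspan_scale in blast)
  finally show ?thesis .
qed

abbreviation emb :: "('v, 'e, 'k) free_elt set \<Rightarrow> ('k, ('v, 'e, 'k) free_elt set) algebra_product" where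
  "emb \<equiv> embed R qscale"

abbreviation at_R :: "('k, ('v, 'e, 'k) free_elt set) algebra_product \<Rightarrow> ('v, 'e, 'k) free_elt set" where
  "at_R \<equiv> component R qscale"

lemmas at_R_simps = component_simps[OF R.scalar_algebra_axioms] component_scale[OF R.scalar_algebra_axioms]
lemmas at_R_closed = component_closed[OF R.scalar_algebra_axioms]

lemma emb_L:
  assumes "x \<in> carrier R"
  shows "emb x \<in> L"
proof -
  obtain f where "f \<in> carrier F" "x = J +>\<^bsub>F\<^esub> f"
    using assms unfolding R_eq by (rule two_sided_ideal.rcosetsE[OF ideal_J])
  then show ?thesis using cls_L[of f] unfolding cls_def by simp
qed

lemma at_R_V: "v \<in> verts E \<Longrightarrow> at_R (cls (monomial [Vtx v])) = lpa_vertex K E v"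
  unfolding cls_def lpa_vertex_def
  by (rule R.component_embed[OF rcoset_closed[OF monomial_closed[OF words(1)]]])

lemma lpa_vertex_closed: "v \<in> verts E \<Longrightarrow> lpa_vertex K E v \<in> carrier R"
  unfolding lpa_vertex_def by (rule rcoset_closed[OF monomial_closed[OF words(1)]])

section \<open>The ideal of a hereditary set as a span of monomials\<close>

context
  fixes H
  assumes H: "hereditary E H"
begin

lemma ideal_lpa_ideal: "two_sided_ideal (lpa_ideal K E H) R"
  unfolding lpa_ideal_def
  by (rule R.two_sided_ideal_gen_ideal) (use lpa_vertex_closed hereditary_subset[OF H] in blast)

lemma lpa_vertex_mem: "v \<in> H \<Longrightarrow> lpa_vertex K E v \<in> lpa_ideal K E H"
  unfolding lpa_ideal_def two_sided_ideal_gen_def by blast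

text \<open>Each monomial factors through its middle vertex, a generator of the ideal. The scalar is
  moved into the left factor because \<open>lpa_ideal\<close> is generated as a ring ideal.\<close>

lemma at_R_lspan_mem:
  assumes "a \<in> lspan H"
  shows "at_R a \<in> lpa_ideal K E H"
  using assms
proof (induction rule: lspan_induct)
  interpret I: two_sided_ideal "lpa_ideal K E H" R by (rule ideal_lpa_ideal)
  case zero
  show ?case using I.zero_closed by (simp add: at_R_simps)
next
  interpret I: two_sided_ideal "lpa_ideal K E H" R by (rule ideal_lpa_ideal)
  case (step c u p u' q v a)
  have v: "v \<in> verts E" using step(1) hereditary_subset[OF H] by blast
  have "at_R (product_scale c (path u p)) \<otimes>\<^bsub>R\<^esub> lpa_vertex K E v \<otimes>\<^bsub>R\<^esub> at_R (ghost u' q)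
      \<in> lpa_ideal K E H"
    by (rule I.ideal_r_closed[OF I.ideal_l_closed[OF lpa_vertex_mem[OF step(1)] at_R_closed] at_R_closed])
  moreover have "product_scale c (path u p * ghost u' q)
      = product_scale c (path u p) * cls (monomial [Vtx v]) * ghost u' q"
    using path_V[OF step(2)] by (simp add: scale_mult_left)
  ultimately show ?case
    using step.IH v by (simp add: at_R_simps at_R_V)
qed

text \<open>The preimage of \<open>lspan H\<close> is a two-sided ideal of \<open>R\<close>
  containing the generating vertices, hence contains the ideal they generate.\<close>

lemma emb_lpa_ideal:
  assumes "x \<in> lpa_ideal K E H"
  shows "emb x \<in> lspan H"
proof -
  have "two_sided_ideal {x \<in> carrier R. emb x \<in> lspan H} R"
    by (rule R.two_sided_idealI)
      (auto simp: R.embed_hom R.embed_minus R.m_closed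
        lspan_0 lspan_add lspan_minus lspan_mult_left[OF H emb_L] lspan_mult_right[OF H _ emb_L])
  moreover have "lpa_vertex K E ` H \<subseteq> {x \<in> carrier R. emb x \<in> lspan H}"
  proof (rule image_subsetI)
    fix v assume v: "v \<in> H"
    then have vE: "v \<in> verts E" using hereditary_subset[OF H] by blast
    have "emb (lpa_vertex K E v) \<in> lspan H"
      using lspan_V[OF v vE] unfolding cls_def lpa_vertex_def .
    then show "lpa_vertex K E v \<in> {x \<in> carrier R. emb x \<in> lspan H}"
      using lpa_vertex_closed[OF vE] by simp
  qed
  ultimately show ?thesis
    using assms unfolding lpa_ideal_def two_sided_ideal_gen_def by blast
qed

end

text \<open>
  A proper ideal of \<open>I(P\<^sub>p\<^sub>p\<^sub>i)\<close> misses a vertex with two closed simple paths; these give nonzero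
  elements of the quotient with product zero.
\<close>

lemma not_division_ring_quot:
  assumes J': "two_sided_ideal J' (R\<lparr>carrier := lpa_ideal K E (P_ppi E)\<rparr>)"
  shows "\<not> division_ring (R\<lparr>carrier := lpa_ideal K E (P_ppi E)\<rparr> Quot J')"
proof
  let ?I = "lpa_ideal K E (P_ppi E)"
  let ?S = "R\<lparr>carrier := ?I\<rparr>"
  let ?Q = "?S Quot J'"
  let ?J = "{z \<in> lspan (P_ppi E). at_R z \<in> J'}"
  interpret I: two_sided_ideal ?I R by (rule ideal_lpa_ideal[OF hereditary_P_ppi])
  interpret J': two_sided_ideal J' ?S by (rule J')
  note emb_I = emb_lpa_ideal[OF hereditary_P_ppi] and at_R_I = at_R_lspan_mem[OF hereditary_P_ppi]
  have S_ops: "\<zero>\<^bsub>?S\<^esub> = \<zero>\<^bsub>R\<^esub>" "x \<oplus>\<^bsub>?S\<^esub> y = x \<oplus>\<^bsub>R\<^esub> y" "x \<otimes>\<^bsub>?S\<^esub> y = x \<otimes>\<^bsub>R\<^esub> y" for x y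
    by simp_all
  have J'_zero: "\<zero>\<^bsub>R\<^esub> \<in> J'" using additive_subgroup.zero_closed[OF J'.is_additive_subgroup] unfolding S_ops .
  have J'_add: "x \<oplus>\<^bsub>R\<^esub> y \<in> J'" if "x \<in> J'" "y \<in> J'" for x y
    using additive_subgroup.a_closed[OF J'.is_additive_subgroup that] unfolding S_ops .
  have J'_mult: "x \<otimes>\<^bsub>R\<^esub> y \<in> J'" "y \<otimes>\<^bsub>R\<^esub> x \<in> J'" if "x \<in> J'" "y \<in> ?I" for x y
    using J'.ideal_r_closed[OF that(1), of y] J'.ideal_l_closed[OF that(1), of y] that(2)
    unfolding S_ops by simp_all
  assume "division_ring ?Q"
  then obtain u where u: "ring (?Q\<lparr>one := u\<rparr>)" "u \<noteq> \<zero>\<^bsub>?Q\<^esub>"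
    "Units (?Q\<lparr>one := u\<rparr>) = carrier ?Q - {\<zero>\<^bsub>?Q\<^esub>}"
    unfolding division_ring_def by blast
  interpret Q: ring "?Q\<lparr>one := u\<rparr>" by (rule u(1))
  have "u \<in> carrier ?Q" using Q.one_closed by simp
  \<comment> \<open>As \<open>u\<close> is not zero, its representative lies outside
    \<open>J'\<close>; this is the element to which \<open>zero_divisors_outside\<close> is
    applied.\<close>
  then obtain a where a: "a \<in> carrier ?S" "u = J' +>\<^bsub>?S\<^esub> a" by (rule J'.rcosetsE)
  have aI: "a \<in> ?I" using a(1) by simp
  have aJ: "a \<notin> J'" using u(2) J'.rcoset_zero a(2) by (auto simp: J'.quot_zero)
  have "\<exists>s\<in>lspan (P_ppi E). \<exists>t\<in>lspan (P_ppi E). s \<notin> ?J \<and> t \<notin> ?J \<and> s * t = 0"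
  proof (rule zero_divisors_outside[of "emb a"])
    show "emb a \<in> lspan (P_ppi E)" by (rule emb_I[OF aI])
    show "emb a \<notin> ?J" using R.component_embed I.a_Hcarr[OF aI] aJ by simp
    show "?J \<subseteq> lspan (P_ppi E)" by blast
    show "0 \<in> ?J" using J'_zero lspan_0 by (simp add: at_R_simps)
    show "x + y \<in> ?J" if "x \<in> ?J" "y \<in> ?J" for x y
      using that J'_add by (simp add: at_R_simps lspan_add)
    show "x * y \<in> ?J \<and> y * x \<in> ?J" if x: "x \<in> ?J" and y: "y \<in> lspan (P_ppi E)" for x y
    proof -
      have yL: "y \<in> L" using y lspan_subset_L[OF hereditary_P_ppi] by blast
      have "at_R x \<otimes>\<^bsub>R\<^esub> at_R y \<in> J'" "at_R y \<otimes>\<^bsub>R\<^esub> at_R x \<in> J'"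
        using J'_mult[OF _ at_R_I[OF y]] x by simp_all
      then show ?thesis
        using x lspan_mult_left[OF hereditary_P_ppi yL] lspan_mult_right[OF hereditary_P_ppi _ yL]
        by (simp add: at_R_simps)
    qed
  qed
  then obtain s t where s: "s \<in> lspan (P_ppi E)" "at_R s \<notin> J'"
    and t: "t \<in> lspan (P_ppi E)" "at_R t \<notin> J'" and st: "s * t = 0"
    by blast
  have unit: "J' +>\<^bsub>?S\<^esub> at_R z \<in> Units (?Q\<lparr>one := u\<rparr>)"
    if "z \<in> lspan (P_ppi E)" "at_R z \<notin> J'" for z
    unfolding u(3) J'.quot_zero
    using J'.rcoset_in_quot J'.rcoset_zero_iff at_R_I[OF that(1)] that(2) by simp
  have "(J' +>\<^bsub>?S\<^esub> at_R s) \<otimes>\<^bsub>?Q\<^esub> (J' +>\<^bsub>?S\<^esub> at_R t) = J' +>\<^bsub>?S\<^esub> (at_R s \<otimes>\<^bsub>R\<^esub> at_R t)"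
    using J'.quot_mult[of "at_R s" "at_R t"] at_R_I s(1) t(1) by simp
  also have "at_R s \<otimes>\<^bsub>R\<^esub> at_R t = \<zero>\<^bsub>?S\<^esub>"
    using at_R_simps(5)[of s t] at_R_simps(1) st by simp
  also have "J' +>\<^bsub>?S\<^esub> \<zero>\<^bsub>?S\<^esub> = \<zero>\<^bsub>?Q\<^esub>"
    unfolding J'.quot_zero by (rule J'.rcoset_zero[OF additive_subgroup.zero_closed[OF J'.is_additive_subgroup]])
  finally have "\<zero>\<^bsub>?Q\<^esub> \<in> Units (?Q\<lparr>one := u\<rparr>)"
    using Q.Units_m_closed[OF unit[OF s] unit[OF t]] by simp
  then show False unfolding u(3) by blast
qed

text \<open>\<open>emb a\<close> lies in its own exposed ideal, hence so do all \<open>x a y\<close>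
  and their sums. The induction on the number of summands carries the sum of the record structure
  through \<open>emb\<close>.\<close>

lemma emb_sandwich:
  assumes a: "a \<in> lpa_ideal K E (P_ppi E)"
    and b: "b \<in> sandwich (R\<lparr>carrier := lpa_ideal K E (P_ppi E)\<rparr>) a"
  shows "b \<in> carrier R \<and> emb b \<in> exposed_ideal (emb a)"
proof -
  let ?I = "lpa_ideal K E (P_ppi E)"
  let ?S = "R\<lparr>carrier := ?I\<rparr>"
  interpret I: two_sided_ideal ?I R by (rule ideal_lpa_ideal[OF hereditary_P_ppi])
  interpret S: nonunital_ring ?S by (rule I.nonunital_ring_ideal)
  have ideal: "L_ideal (exposed_ideal (emb a))" by (rule L_ideal_exposed_ideal)
  have ea: "emb a \<in> exposed_ideal (emb a)"
    using mem_exposed_ideal emb_lpa_ideal[OF hereditary_P_ppi a] by blast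
  obtain n :: nat and x y where b_eq: "b = (\<Oplus>\<^bsub>?S\<^esub>i\<in>{..<n}. x i \<otimes>\<^bsub>?S\<^esub> a \<otimes>\<^bsub>?S\<^esub> y i)"
    and xy: "x \<in> {..<n} \<rightarrow> carrier ?S" "y \<in> {..<n} \<rightarrow> carrier ?S"
    using b unfolding sandwich_def by blast
  define f where "f i = x i \<otimes>\<^bsub>R\<^esub> a \<otimes>\<^bsub>R\<^esub> y i" for i
  have f: "f i \<in> ?I" "emb (f i) \<in> exposed_ideal (emb a)" if "i < n" for i
  proof -
    have c: "x i \<in> carrier R" "a \<in> carrier R" "y i \<in> carrier R"
      using xy a that I.a_Hcarr by (auto simp: Pi_iff)
    show "f i \<in> ?I" unfolding f_def using I.ideal_l_closed I.ideal_r_closed a c by simp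
    have "emb (f i) = emb (x i) * emb a * emb (y i)"
      unfolding f_def using c R.m_closed by (simp add: R.embed_hom)
    then show "emb (f i) \<in> exposed_ideal (emb a)"
      using L_ideal_mult[OF ideal] ea emb_L c by simp
  qed
  have "m \<le> n \<Longrightarrow> (\<Oplus>\<^bsub>?S\<^esub>i\<in>{..<m}. f i) \<in> ?I \<and> emb (\<Oplus>\<^bsub>?S\<^esub>i\<in>{..<m}. f i) \<in> exposed_ideal (emb a)" for m
  proof (induction m)
    case 0
    show ?case
      using additive_subgroup.zero_closed[OF I.is_additive_subgroup] subspace_0[OF L_ideal_subspace[OF ideal]] by (simp add: R.embed_hom)
  next
    case (Suc m)
    let ?s = "\<Oplus>\<^bsub>?S\<^esub>i\<in>{..<m}. f i"
    have IH: "?s \<in> ?I" "emb ?s \<in> exposed_ideal (emb a)" using Suc by simp_all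
    have fm: "f m \<in> ?I" "emb (f m) \<in> exposed_ideal (emb a)" using f Suc.prems by simp_all
    have "(\<Oplus>\<^bsub>?S\<^esub>i\<in>{..<Suc m}. f i) = f m \<oplus>\<^bsub>?S\<^esub> ?s"
      unfolding lessThan_Suc using f Suc.prems by (intro S.finsum_insert) (auto simp: Pi_iff)
    then have "(\<Oplus>\<^bsub>?S\<^esub>i\<in>{..<Suc m}. f i) = f m \<oplus>\<^bsub>R\<^esub> ?s" by simp
    then show ?case
      using additive_subgroup.a_closed[OF I.is_additive_subgroup] fm IH subspace_add[OF L_ideal_subspace[OF ideal]] I.a_Hcarr
      by (simp add: R.embed_hom)
  qed
  from this[of n] show ?thesis unfolding b_eq using I.a_Hcarr by (simp add: f_def)
qed

lemma purely_infinite_lpa_ideal: "purely_infinite (R\<lparr>carrier := lpa_ideal K E (P_ppi E)\<rparr>)"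
  unfolding purely_infinite_def
proof (intro conjI allI impI ballI)
  let ?I = "lpa_ideal K E (P_ppi E)"
  let ?S = "R\<lparr>carrier := ?I\<rparr>"
  interpret I: two_sided_ideal ?I R by (rule ideal_lpa_ideal[OF hereditary_P_ppi])
  show "nonunital_ring ?S" by (rule I.nonunital_ring_ideal)
  show "\<not> division_ring (?S Quot J')" if "two_sided_ideal J' ?S" for J'
    by (rule not_division_ring_quot[OF that])
  fix a b assume "a \<in> carrier ?S" and b: "b \<in> sandwich ?S a"
  then have a: "a \<in> ?I" by simp
  have eb: "b \<in> carrier R" "emb b \<in> exposed_ideal (emb a)" using emb_sandwich[OF a b] by auto
  obtain x y where xy: "x \<in> lspan (P_ppi E)" "y \<in> lspan (P_ppi E)" "emb b = x * emb a * y"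
    using exposed_ideal_factorization[OF emb_lpa_ideal[OF hereditary_P_ppi a] eb(2)] by blast
  \<comment> \<open>The factors \<open>x\<close> and \<open>y\<close> live in the product ring;
    their components at \<open>R\<close> belong to the ideal, and \<open>at_R\<close> respects
    products.\<close>
  have "b = at_R (emb b)" using R.component_embed[OF eb(1)] by simp
  also have "\<dots> = at_R x \<otimes>\<^bsub>R\<^esub> a \<otimes>\<^bsub>R\<^esub> at_R y"
    using R.component_embed[OF I.a_Hcarr[OF a]] by (simp add: xy(3) at_R_simps)
  finally have "b = at_R x \<otimes>\<^bsub>?S\<^esub> a \<otimes>\<^bsub>?S\<^esub> at_R y" by simp
  moreover have "at_R x \<in> carrier ?S" "at_R y \<in> carrier ?S"
    using at_R_lspan_mem[OF hereditary_P_ppi] xy by simp_all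
  ultimately show "\<exists>x\<in>carrier ?S. \<exists>y\<in>carrier ?S. b = x \<otimes>\<^bsub>?S\<^esub> a \<otimes>\<^bsub>?S\<^esub> y" by blast
qed

end

theorem proposition4p11:
  fixes E :: "('v, 'e) pre_digraph" and K :: "'k::field itself"
  assumes "wf_digraph E"
  shows "purely_infinite ((leavitt_path_algebra K E)\<lparr>carrier := lpa_ideal K E (P_ppi E)\<rparr>)"
proof -
  interpret leavitt_algebra E K by (rule leavitt_algebra.intro[OF assms])
  show ?thesis by (rule purely_infinite_lpa_ideal)
qed


end
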